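(* Let $\rho_0\ne\rho_1$ be qubit density operators and $a,b>0$, $a+b=1$. If $\omega_\mu$ is not a multiple of $\mathbf 1$, then $I_{\mathrm{TD}}$ has a unique finite maximizer $\lambda_{\max}$ and $$I_{\mathrm{TD}}'(\lambda)>0\quad(\lambda<\lambda_{\max}),\qquad I_{\mathrm{TD}}'(\lambda)<0\quad(\lambda>\lambda_{\max})$$ whenever the derivative is represented in a nonsingular chart. Consequently: (1) $I_{\mathrm{TD}}$ is quasi-concave on the extended line $[-\infty,+\infty]$ with the two endpoints identified; (2) the restriction of $I_{\mathrm{TD}}$ to the finite interval $[-\lambda_*,\lambda_*]$ is pseudo-concave; (3) every stationary point of $I_{\mathrm{TD}}$ in this finite interval is globally maximizing. If $\omega_\mu$ is a multiple of $\mathbf 1$, then $\rho_0$ and $\rho_1$ commute, $I_{\mathrm{TD}}$ is constant on every nondegenerate branch (i.e. wherever $H(\lambda)$ has two distinct eigenvalues), and the non-strict forms of quasi-concavity and pseudo-concavity hold.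
   Context: Let $\Delta=\rho_0-\rho_1\ne0$, $$\mu=\frac{\mathrm{Tr}[\rho_1(\rho_1-\rho_0)]}{\mathrm{Tr}[(\rho_0-\rho_1)^2]},\qquad \omega_\mu=\mu\rho_0+(1-\mu)\rho_1,\qquad H(\lambda)=\lambda\omega_\mu-\Delta .$$ Then $\mathrm{Tr}(\omega_\mu\Delta)=0$. Whenever $H(\lambda)$ has two distinct eigenvalues, its two rank-one spectral projections define a qubit PVM; $I_{\mathrm{TD}}(\lambda)$ is the mutual information between the input letter (prior $a$ for $\rho_0$, $b$ for $\rho_1$) and the outcome of that PVM: with $p=\mathrm{Tr}(\rho_0P)$, $q=\mathrm{Tr}(\rho_1P)$ for one of the projections $P$ and $h(u)=-u\log u-(1-u)\log(1-u)$, it equals $h(ap+bq)-ah(p)-bh(q)$. If $\omega_\mu$ is nonscalar, at $\lambda=\pm\infty$ both limits define the same PVM, the eigenbasis of $\omega_\mu$, and the extended line $\lambda\in[-\infty,\infty]$ (endpoints identified) traverses once the circle of unoriented measurement axes in the Bloch plane of the two states. The interval endpoint is $\lambda_*=\mathrm{Tr}\Delta^2/\sqrt\Xi$ with $\Xi=\mathrm{Tr}\Delta^2-\mathrm{Tr}(\rho_0^2)\mathrm{Tr}(\rho_1^2)+(\mathrm{Tr}\rho_0\rho_1)^2$. Quasi-concave: all upper level sets are intervals. A differentiable function $I$ of one variable is pseudo-concave if $I(y)>I(x)$ implies $I'(x)(y-x)>0$. *)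

theory Defs
  imports "HOL-Probability.Probability"
begin

section \<open>Qubit operators\<close>

definition adjoint_matrix :: "complex^'n^'m \<Rightarrow> complex^'m^'n" where
  "adjoint_matrix A = (\<chi> i j. cnj (A $ j $ i))"

definition self_adjoint :: "complex^'n^'n \<Rightarrow> bool" where
  "self_adjoint A \<longleftrightarrow> adjoint_matrix A = A"

definition positive_semidefinite :: "complex^'n^'n \<Rightarrow> bool" where
  "positive_semidefinite A \<longleftrightarrow>
     self_adjoint A \<and> (\<forall>v. 0 \<le> Re (\<Sum>i\<in>UNIV. cnj (v $ i) * (A *v v) $ i))"

definition density_operator :: "complex^'n^'n \<Rightarrow> bool" where
  "density_operator \<rho> \<longleftrightarrow> positive_semidefinite \<rho> \<and> trace \<rho> = 1"

definition scalar_operator :: "complex^'n^'n \<Rightarrow> bool" where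
  "scalar_operator A \<longleftrightarrow> (\<exists>c. A = mat c)"

definition eigenspace :: "complex^'n^'n \<Rightarrow> complex \<Rightarrow> (complex^'n) set" where
  "eigenspace A e = {v. A *v v = e *s v}"

definition eigenvalues :: "complex^'n^'n \<Rightarrow> complex set" where
  "eigenvalues A = {e. \<exists>v. v \<noteq> 0 \<and> v \<in> eigenspace A e}"

definition nondegenerate :: "complex^2^2 \<Rightarrow> bool" where
  "nondegenerate A \<longleftrightarrow> (\<exists>e\<in>eigenvalues A. \<exists>e'\<in>eigenvalues A. e \<noteq> e')"

text \<open>The orthogonal projection onto one full eigenspace. For a nondegenerate self-adjoint
  operator on a qubit there are exactly two of these, \<open>P\<close> and \<open>1 - P\<close>, both of rank one.\<close>

definition spectral_projection :: "complex^'n^'n \<Rightarrow> complex^'n^'n \<Rightarrow> bool" where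
  "spectral_projection A P \<longleftrightarrow>
     self_adjoint P \<and> P ** P = P \<and> (\<exists>e\<in>eigenvalues A. range ((*v) P) = eigenspace A e)"


section \<open>Mutual information of a two-letter ensemble and a two-outcome measurement\<close>

text \<open>The letter \<open>True\<close> stands for \<open>\<rho>0\<close> and has prior \<open>a\<close>; \<open>False\<close> stands for \<open>\<rho>1\<close> and has
  prior \<open>b = 1 - a\<close>. The outcome \<open>True\<close> is the one belonging to \<open>P\<close>.\<close>

definition born :: "complex^'n^'n \<Rightarrow> complex^'n^'n \<Rightarrow> real" where
  "born \<rho> P = Re (trace (\<rho> ** P))"

definition letter_outcome_pmf ::
  "real \<Rightarrow> complex^'n^'n \<Rightarrow> complex^'n^'n \<Rightarrow> complex^'n^'n \<Rightarrow> (bool \<times> bool) pmf" where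
  "letter_outcome_pmf a \<rho>0 \<rho>1 P =
     bind_pmf (bernoulli_pmf a)
       (\<lambda>x. map_pmf (Pair x) (bernoulli_pmf (born (if x then \<rho>0 else \<rho>1) P)))"

text \<open>Natural logarithms, i.e. base \<open>exp 1\<close>.\<close>

definition letter_outcome_information ::
  "real \<Rightarrow> complex^'n^'n \<Rightarrow> complex^'n^'n \<Rightarrow> complex^'n^'n \<Rightarrow> real" where
  "letter_outcome_information a \<rho>0 \<rho>1 P =
     prob_space.mutual_information (measure_pmf (letter_outcome_pmf a \<rho>0 \<rho>1 P)) (exp 1)
       (count_space UNIV) (count_space UNIV) fst snd"

text \<open>The choice of \<open>P\<close> among the two spectral projections is immaterial, see
  \<open>pvm_information_eq\<close> below, and such a \<open>P\<close> exists for every finite parameter, see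
  \<open>spectral_projection_exists\<close> and \<open>H_nondegenerate\<close>.\<close>

definition pvm_information ::
  "real \<Rightarrow> complex^2^2 \<Rightarrow> complex^2^2 \<Rightarrow> complex^2^2 \<Rightarrow> real" where
  "pvm_information a \<rho>0 \<rho>1 A =
     letter_outcome_information a \<rho>0 \<rho>1 (SOME P. spectral_projection A P)"


section \<open>The one-parameter family of measurements\<close>

definition mu :: "complex^2^2 \<Rightarrow> complex^2^2 \<Rightarrow> real" where
  "mu \<rho>0 \<rho>1 = Re (trace (\<rho>1 ** (\<rho>1 - \<rho>0))) / Re (trace ((\<rho>0 - \<rho>1) ** (\<rho>0 - \<rho>1)))"

definition omega_mu :: "complex^2^2 \<Rightarrow> complex^2^2 \<Rightarrow> complex^2^2" where
  "omega_mu \<rho>0 \<rho>1 = mu \<rho>0 \<rho>1 *\<^sub>R \<rho>0 + (1 - mu \<rho>0 \<rho>1) *\<^sub>R \<rho>1"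

definition H :: "complex^2^2 \<Rightarrow> complex^2^2 \<Rightarrow> real \<Rightarrow> complex^2^2" where
  "H \<rho>0 \<rho>1 l = l *\<^sub>R omega_mu \<rho>0 \<rho>1 - (\<rho>0 - \<rho>1)"

text \<open>At both infinite endpoints the measurement is the eigenbasis of \<open>\<omega>\<^sub>\<mu>\<close>.\<close>

definition H_ext :: "complex^2^2 \<Rightarrow> complex^2^2 \<Rightarrow> ereal \<Rightarrow> complex^2^2" where
  "H_ext \<rho>0 \<rho>1 x = (if \<bar>x\<bar> = \<infinity> then omega_mu \<rho>0 \<rho>1 else H \<rho>0 \<rho>1 (real_of_ereal x))"

definition I_TD :: "real \<Rightarrow> complex^2^2 \<Rightarrow> complex^2^2 \<Rightarrow> real \<Rightarrow> real" where
  "I_TD a \<rho>0 \<rho>1 l = pvm_information a \<rho>0 \<rho>1 (H \<rho>0 \<rho>1 l)"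

definition I_TD_ext :: "real \<Rightarrow> complex^2^2 \<Rightarrow> complex^2^2 \<Rightarrow> ereal \<Rightarrow> real" where
  "I_TD_ext a \<rho>0 \<rho>1 x = pvm_information a \<rho>0 \<rho>1 (H_ext \<rho>0 \<rho>1 x)"

definition Xi :: "complex^2^2 \<Rightarrow> complex^2^2 \<Rightarrow> real" where
  "Xi \<rho>0 \<rho>1 = Re (trace ((\<rho>0 - \<rho>1) ** (\<rho>0 - \<rho>1)))
     - Re (trace (\<rho>0 ** \<rho>0)) * Re (trace (\<rho>1 ** \<rho>1)) + (Re (trace (\<rho>0 ** \<rho>1)))\<^sup>2"

definition lambda_star :: "complex^2^2 \<Rightarrow> complex^2^2 \<Rightarrow> real" where
  "lambda_star \<rho>0 \<rho>1 = Re (trace ((\<rho>0 - \<rho>1) ** (\<rho>0 - \<rho>1))) / sqrt (Xi \<rho>0 \<rho>1)"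


section \<open>Generalised concavity\<close>

definition order_interval :: "'a::linorder set \<Rightarrow> bool" where
  "order_interval S \<longleftrightarrow> (\<forall>x\<in>S. \<forall>y\<in>S. {x..y} \<subseteq> S)"

definition quasi_concave_on :: "'a::linorder set \<Rightarrow> ('a \<Rightarrow> real) \<Rightarrow> bool" where
  "quasi_concave_on S f \<longleftrightarrow> (\<forall>c. order_interval {x\<in>S. c \<le> f x})"

text \<open>The derivative is taken within \<open>S\<close>, hence one-sided at the endpoints of a closed interval.\<close>

definition pseudo_concave_on :: "real set \<Rightarrow> (real \<Rightarrow> real) \<Rightarrow> bool" where
  "pseudo_concave_on S f \<longleftrightarrow>
     (\<exists>f'. (\<forall>x\<in>S. (f has_real_derivative f' x) (at x within S)) \<and>
           (\<forall>x\<in>S. \<forall>y\<in>S. f x < f y \<longrightarrow> 0 < f' x * (y - x)))"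


section \<open>The information is well defined\<close>

definition binary_entropy :: "real \<Rightarrow> real" where
  "binary_entropy u = - u * ln u - (1 - u) * ln (1 - u)"

lemma letter_outcome_information_eq:
  fixes \<rho>0 \<rho>1 P :: "complex^'n^'n"
  assumes a: "0 < a" "a < 1"
    and p: "born \<rho>0 P \<in> {0..1}" and q: "born \<rho>1 P \<in> {0..1}"
  shows "letter_outcome_information a \<rho>0 \<rho>1 P =
    binary_entropy (a * born \<rho>0 P + (1 - a) * born \<rho>1 P)
      - a * binary_entropy (born \<rho>0 P) - (1 - a) * binary_entropy (born \<rho>1 P)"
proof -
  define p where "p = born \<rho>0 P"
  define q where "q = born \<rho>1 P"
  define s where "s = a * p + (1 - a) * q"
  define J where "J = letter_outcome_pmf a \<rho>0 \<rho>1 P"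
  have pq: "0 \<le> p" "p \<le> 1" "0 \<le> q" "q \<le> 1"
    using p q by (auto simp: p_def q_def)
  interpret information_space "measure_pmf J" "exp 1"
    by unfold_locales auto
  define Pxy where "Pxy = (\<lambda>z::bool \<times> bool. (if fst z then a else 1 - a) *
     (if fst z then (if snd z then p else 1 - p) else (if snd z then q else 1 - q)))"
  have pm: "pmf (map_pmf (Pair x) r) (x', y) = (if x = x' then pmf r y else 0)" for x x' :: bool and r y
  proof (cases "x = x'")
    case True
    then show ?thesis by (simp add: pmf_map_inj' inj_on_def)
  next
    case False
    then show ?thesis by (auto simp: pmf_eq_0_set_pmf)
  qed
  have pmfJ: "pmf J z = Pxy z" for z
    using a pq unfolding J_def letter_outcome_pmf_def Pxy_def p_def[symmetric] q_def[symmetric]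
    by (cases z) (auto simp: pmf_bind p_def[symmetric] q_def[symmetric] pm)
  have vx: "fst -` {x} = {(x, True), (x, False)}" for x :: bool
  proof (rule set_eqI)
    show "z \<in> fst -` {x} \<longleftrightarrow> z \<in> {(x, True), (x, False)}" for z
      by (cases z; cases "snd z") simp_all
  qed
  have vy: "snd -` {y} = {(True, y), (False, y)}" for y :: bool
  proof (rule set_eqI)
    show "z \<in> snd -` {y} \<longleftrightarrow> z \<in> {(True, y), (False, y)}" for z
      by (cases z; cases "fst z") simp_all
  qed
  have sf: "simple_function (measure_pmf J) f" for f :: "bool \<times> bool \<Rightarrow> 'b::finite"
    by (simp add: simple_function_def)
  have "0 \<le> s" by (use a pq in \<open>simp add: s_def\<close>)
  have s1: "1 - s = a * (1 - p) + (1 - a) * (1 - q)" by (simp add: s_def algebra_simps)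
  have "s \<le> 1"
    using s1 a pq by (metis add_nonneg_nonneg diff_ge_0_iff_ge less_imp_le mult_nonneg_nonneg)
  have X: "simple_distributed (measure_pmf J) fst (\<lambda>x. if x then a else 1 - a)"
  proof (rule measure_pmf.simple_distributedI[OF sf])
    show "(if x then a else 1 - a) = measure (measure_pmf J) (fst -` {x} \<inter> space (measure_pmf J))" for x
      by (simp add: vx measure_measure_pmf_finite pmfJ Pxy_def algebra_simps)
  qed (use a in simp)
  have Y: "simple_distributed (measure_pmf J) snd (\<lambda>y. if y then s else 1 - s)"
  proof (rule measure_pmf.simple_distributedI[OF sf])
    show "(if y then s else 1 - s) = measure (measure_pmf J) (snd -` {y} \<inter> space (measure_pmf J))" for y
      by (simp add: vy measure_measure_pmf_finite pmfJ Pxy_def s1) (simp add: s_def)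
  qed (use \<open>0 \<le> s\<close> \<open>s \<le> 1\<close> in simp)
  have XY: "simple_distributed (measure_pmf J) (\<lambda>x. (fst x, snd x)) Pxy"
  proof (rule measure_pmf.simple_distributedI[OF sf])
    show "Pxy z = measure (measure_pmf J) ((\<lambda>x. (fst x, snd x)) -` {z} \<inter> space (measure_pmf J))" for z
      by (simp add: vimage_def measure_pmf_single pmfJ)
  qed (use a pq in \<open>simp add: Pxy_def\<close>)
  have U: "(UNIV :: (bool\<times>bool) set) = {(True,True),(True,False),(False,True),(False,False)}"
  proof (rule set_eqI)
    show "z \<in> UNIV \<longleftrightarrow> z \<in> {(True,True),(True,False),(False,True),(False,False)}" for z :: "bool \<times> bool"
      by (cases z; cases "fst z"; cases "snd z") simp_all
  qed
  have "letter_outcome_information a \<rho>0 \<rho>1 P = prob_space.mutual_information (measure_pmf J) (exp 1)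
    (count_space (fst ` space (measure_pmf J))) (count_space (snd ` space (measure_pmf J))) fst snd"
    unfolding letter_outcome_information_def J_def[symmetric] by simp
  also have "\<dots> = (\<Sum>(x, y)\<in>(\<lambda>x. (fst x, snd x)) ` space (measure_pmf J).
     Pxy (x, y) * log (exp 1) (Pxy (x, y) / ((if x then a else 1 - a) * (if y then s else 1 - s))))"
    by (rule mutual_information_simple_distributed[OF X Y XY])
  also have "\<dots> = a * p * ln (a * p / (a * s)) + a * (1 - p) * ln (a * (1 - p) / (a * (1 - s)))
      + (1 - a) * q * ln ((1 - a) * q / ((1 - a) * s)) + (1 - a) * (1 - q) * ln ((1 - a) * (1 - q) / ((1 - a) * (1 - s)))"
    by (simp add: U Pxy_def log_def)
  also have "a * p * ln (a * p / (a * s)) = a * p * (ln p - ln s)"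
  proof (cases "p = 0")
    case False
    with pq a have "p > 0" "s > 0" by (auto simp: s_def add_pos_nonneg)
    with a show ?thesis by (simp add: ln_div)
  qed simp
  also have "a * (1 - p) * ln (a * (1 - p) / (a * (1 - s))) = a * (1 - p) * (ln (1 - p) - ln (1 - s))"
  proof (cases "p = 1")
    case False
    with s1 pq a have "1 - p > 0" "1 - s > 0" by (auto simp: add_pos_nonneg)
    with a show ?thesis by (simp add: ln_div)
  qed simp
  also have "(1 - a) * q * ln ((1 - a) * q / ((1 - a) * s)) = (1 - a) * q * (ln q - ln s)"
  proof (cases "q = 0")
    case False
    with pq a have "q > 0" "s > 0" by (auto simp: s_def add_nonneg_pos)
    with a show ?thesis by (simp add: ln_div)
  qed simp
  also have "(1 - a) * (1 - q) * ln ((1 - a) * (1 - q) / ((1 - a) * (1 - s))) = (1 - a) * (1 - q) * (ln (1 - q) - ln (1 - s))"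
  proof (cases "q = 1")
    case False
    with s1 pq a have "1 - q > 0" "1 - s > 0" by (auto simp: add_nonneg_pos)
    with a show ?thesis by (simp add: ln_div)
  qed simp
  finally show ?thesis
    unfolding p_def[symmetric] q_def[symmetric] s_def[symmetric] binary_entropy_def
    by (simp add: s_def algebra_simps)
qed

lemma adjoint_form:
  fixes A :: "complex^'n^'n"
  shows "(\<Sum>i\<in>UNIV. cnj (u $ i) * (A *v v) $ i) = (\<Sum>i\<in>UNIV. cnj ((adjoint_matrix A *v u) $ i) * v $ i)"
  by (simp add: matrix_vector_mult_def adjoint_matrix_def sum_distrib_left sum_distrib_right)
    (subst sum.swap, simp add: mult_ac)

lemma adjoint_matrix_mult: "adjoint_matrix (A ** B) = adjoint_matrix B ** adjoint_matrix A"
  by (simp add: adjoint_matrix_def matrix_matrix_mult_def vec_eq_iff mult.commute)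

lemma born_nonneg:
  fixes P :: "complex^'n^'n"
  assumes "density_operator \<rho>" "self_adjoint P" "P ** P = P"
  shows "0 \<le> born \<rho> P"
proof -
  have "trace (\<rho> ** P) = trace (\<rho> ** P ** P)"
    using assms(3) by (metis matrix_mul_assoc)
  also have "\<dots> = trace (P ** (\<rho> ** P))"
    by (rule trace_mul_sym)
  also have "\<dots> = (\<Sum>j\<in>UNIV. \<Sum>i\<in>UNIV. cnj ((column j P) $ i) * (\<rho> *v column j P) $ i)"
  proof -
    have Pji: "P $ j $ i = cnj (P $ i $ j)" for i j
      using arg_cong[OF assms(2)[unfolded self_adjoint_def], of "\<lambda>M. M $ j $ i"]
      by (simp add: adjoint_matrix_def)
    have "(\<Sum>j\<in>UNIV. \<Sum>i\<in>UNIV. P $ j $ i * (\<rho> ** P) $ i $ j) =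
        (\<Sum>j\<in>UNIV. \<Sum>i\<in>UNIV. cnj (P $ i $ j) * (\<rho> ** P) $ i $ j)"
      by (intro sum.cong refl arg_cong2[where f = "(*)", OF Pji refl])
    then show ?thesis
      unfolding trace_def
      by (simp add: matrix_matrix_mult_def matrix_vector_mult_def column_def)
  qed
  finally show ?thesis
    using assms(1) unfolding born_def density_operator_def positive_semidefinite_def
    by (simp add: sum_nonneg)
qed

lemma matrix_diff_distrib:
  fixes A B C :: "complex^'n^'n"
  shows "A ** (B - C) = A ** B - A ** C" "(A - B) ** C = A ** C - B ** C"
  by (simp_all add: matrix_matrix_mult_def vec_eq_iff algebra_simps sum_subtractf)

lemma born_complement: "trace \<rho> = 1 \<Longrightarrow> born \<rho> (mat 1 - P) = 1 - born \<rho> P"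
  by (simp add: born_def matrix_diff_distrib trace_sub)

lemma born_mem:
  fixes P :: "complex^'n^'n"
  assumes "density_operator \<rho>" "self_adjoint P" "P ** P = P"
  shows "born \<rho> P \<in> {0..1}"
proof -
  have "self_adjoint (mat 1 - P)"
    using assms(2) by (simp add: self_adjoint_def adjoint_matrix_def vec_eq_iff mat_def)
  moreover have "(mat 1 - P) ** (mat 1 - P) = mat 1 - P"
    using assms(3) by (simp add: matrix_diff_distrib)
  ultimately have "0 \<le> born \<rho> (mat 1 - P)"
    using born_nonneg assms(1) by blast
  then show ?thesis
    using born_nonneg[OF assms] born_complement[of \<rho> P] assms(1) by (simp add: density_operator_def)
qed

lemma mult_form_sym:
  fixes A :: "complex^'n^'n"
  assumes "self_adjoint A"
  shows "(\<Sum>i\<in>UNIV. cnj ((A *v u) $ i) * v $ i) = (\<Sum>i\<in>UNIV. cnj (u $ i) * (A *v v) $ i)"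
  using adjoint_form[of u A v] assms by (simp add: self_adjoint_def)

lemma eigenvectors_orthogonal:
  fixes A :: "complex^'n^'n"
  assumes A: "self_adjoint A" and "u \<in> eigenspace A e" "v \<in> eigenspace A e'" "e \<noteq> e'"
  shows "(\<Sum>i\<in>UNIV. cnj (u $ i) * v $ i) = 0"
proof -
  have *: "cnj f * (\<Sum>i\<in>UNIV. cnj (w $ i) * x $ i) = f' * (\<Sum>i\<in>UNIV. cnj (w $ i) * x $ i)"
    if "w \<in> eigenspace A f" "x \<in> eigenspace A f'" for w x f f'
    using mult_form_sym[OF A, of w x] that
    by (simp add: eigenspace_def sum_distrib_left mult_ac)
  show ?thesis
  proof (cases "u = 0")
    case False
    then obtain k where "u $ k \<noteq> 0" by (auto simp: vec_eq_iff)
    have "Re (\<Sum>i\<in>UNIV. cnj (u $ i) * u $ i) > 0"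
      unfolding Re_sum by (rule sum_pos2[of _ k])
        (use \<open>u $ k \<noteq> 0\<close> in \<open>auto simp: complex_eq_iff sum_power2_gt_zero_iff simp flip: power2_eq_square\<close>)
    then have "(\<Sum>i\<in>UNIV. cnj (u $ i) * u $ i) \<noteq> 0" by (metis less_irrefl zero_complex.simps(1))
    with *[OF assms(2,2)] have "cnj e = e" by simp
    with *[OF assms(2,3)] assms(4) show ?thesis by simp
  qed simp
qed

lemma mult_smult: "A *v (c *s x) = c *s (A *v x)" for A :: "complex^'n^'m"
  by (simp add: matrix_vector_mult_def vec_eq_iff sum_distrib_left mult_ac)

lemma eigenvectors_span:
  fixes A :: "complex^2^2"
  assumes u: "u \<in> eigenspace A e" "u \<noteq> 0" and v: "v \<in> eigenspace A e'" "v \<noteq> 0" and "e \<noteq> e'"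
  obtains c d where "w = c *s u + d *s v"
proof -
  define D where "D = u $ 1 * v $ 2 - u $ 2 * v $ 1"
  have "D \<noteq> 0"
  proof
    assume D: "D = 0"
    obtain k where k: "u $ k \<noteq> 0" using u(2) by (auto simp: vec_eq_iff)
    have *: "v $ i = (v $ k / u $ k) * u $ i" for i
      using D k exhaust_2[of k] exhaust_2[of i] unfolding D_def by (auto simp: field_simps)
    have vu: "v = (v $ k / u $ k) *s u"
      unfolding vec_eq_iff vector_smult_component using * by (rule allI)
    have "A *v v = (v $ k / u $ k) *s (A *v u)"
      by (subst vu) (rule mult_smult)
    also have "\<dots> = e *s ((v $ k / u $ k) *s u)"
      using u(1) by (simp add: eigenspace_def vector_smult_assoc mult.commute)
    also have "(v $ k / u $ k) *s u = v" by (rule vu[symmetric])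
    finally have "A *v v = e *s v" .
    then have "e *s v = e' *s v" using v(1) by (simp add: eigenspace_def)
    then show False using v(2) \<open>e \<noteq> e'\<close> by (simp add: vec_eq_iff)
  qed
  then have "w = ((w $ 1 * v $ 2 - w $ 2 * v $ 1) / D) *s u + ((u $ 1 * w $ 2 - u $ 2 * w $ 1) / D) *s v"
    by (simp add: vec_eq_iff forall_2 field_simps) (simp add: D_def algebra_simps)
  then show ?thesis by (rule that)
qed

lemma projection_fixes: "P ** P = P \<Longrightarrow> w \<in> range ((*v) P) \<Longrightarrow> P *v w = w"
  for P :: "complex^'n^'n"
  by (auto simp: matrix_vector_mul_assoc)

lemma projection_product:
  fixes P Q :: "complex^'n^'n"
  assumes "P ** P = P" "range ((*v) Q) \<subseteq> range ((*v) P)"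
  shows "P ** Q = Q"
proof -
  have "P *v (Q *v x) = Q *v x" for x
    using assms by (intro projection_fixes) auto
  then show ?thesis by (simp add: matrix_eq flip: matrix_vector_mul_assoc)
qed

lemma spectral_projection_unique:
  fixes A P Q :: "complex^2^2"
  assumes A: "self_adjoint A" and P: "spectral_projection A P" and Q: "spectral_projection A Q"
  shows "Q = P \<or> Q = mat 1 - P"
proof -
  obtain e where e: "e \<in> eigenvalues A" "range ((*v) P) = eigenspace A e"
    using P by (auto simp: spectral_projection_def)
  obtain e' where e': "e' \<in> eigenvalues A" "range ((*v) Q) = eigenspace A e'"
    using Q by (auto simp: spectral_projection_def)
  have idem: "P ** P = P" "Q ** Q = Q" and adj: "adjoint_matrix P = P" "adjoint_matrix Q = Q"
    using P Q by (auto simp: spectral_projection_def self_adjoint_def)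
  show ?thesis
  proof (cases "e = e'")
    case True
    then have "P ** Q = Q" "Q ** P = P"
      using e(2) e'(2) projection_product[OF idem(1), of Q] projection_product[OF idem(2), of P]
      by blast+
    then show ?thesis by (metis adj adjoint_matrix_mult)
  next
    case False
    obtain u where u: "u \<in> eigenspace A e" "u \<noteq> 0" using e(1) by (auto simp: eigenvalues_def)
    obtain v where v: "v \<in> eigenspace A e'" "v \<noteq> 0" using e'(1) by (auto simp: eigenvalues_def)
    have orth: "x = 0" if x: "x = R *v y" "R ** R = R" "adjoint_matrix R = R"
      "range ((*v) R) = eigenspace A f" "y \<in> eigenspace A f'" "f \<noteq> f'" for x y f f' and R :: "complex^2^2"
    proof -
      have "R *v x = x" using x by (metis matrix_vector_mul_assoc)
      moreover have "x \<in> eigenspace A f" using x by (metis rangeI)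
      ultimately have "0 = (\<Sum>i\<in>UNIV. cnj (x $ i) * x $ i)"
        using eigenvectors_orthogonal[OF A _ x(5) x(6), of x] mult_form_sym[of R x y] x(1,3)
        by (simp add: self_adjoint_def)
      then have "0 = Re (\<Sum>i\<in>UNIV. cnj (x $ i) * x $ i)" by simp
      then show ?thesis
        by (auto simp: sum_2 vec_eq_iff forall_2 complex_eq_iff simp flip: power2_eq_square)
          (smt (verit) zero_le_power2 power2_less_eq_zero_iff)+
    qed
    have "P *v u = u" "Q *v v = v"
      by (simp_all only: projection_fixes idem e(2) e'(2) u(1) v(1))
    moreover have "P *v v = 0" "Q *v u = 0"
      using orth[OF refl idem(1) adj(1) e(2) v(1) False]
        orth[OF refl idem(2) adj(2) e'(2) u(1) False[symmetric]] by auto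
    ultimately have "(P + Q) *v u = u" "(P + Q) *v v = v"
      by (simp_all add: matrix_vector_mult_add_rdistrib)
    then have "(P + Q) *v w = mat 1 *v w" for w
    proof -
      obtain c d where "w = c *s u + d *s v"
        using eigenvectors_span[OF u v False] by blast
      with \<open>(P + Q) *v u = u\<close> \<open>(P + Q) *v v = v\<close> show ?thesis
        by (simp only: matrix_vector_right_distrib mult_smult matrix_vector_mul_lid)
    qed
    then have "P + Q = mat 1" by (simp add: matrix_eq)
    then show ?thesis by (simp add: eq_diff_eq add.commute)
  qed
qed

lemma spectral_projection_exists:
  fixes A :: "complex^2^2"
  assumes A: "self_adjoint A" and "nondegenerate A"
  shows "\<exists>P. spectral_projection A P"
proof -
  obtain e e' u v where e: "e \<noteq> e'" and u: "u \<in> eigenspace A e" "u \<noteq> 0"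
    and v: "v \<in> eigenspace A e'" "v \<noteq> 0"
    using assms(2) by (auto simp: nondegenerate_def eigenvalues_def)
  define n where "n = (\<Sum>i\<in>UNIV. cnj (u $ i) * u $ i)"
  have n_real: "cnj n = n" by (simp add: n_def mult.commute)
  have n0: "n \<noteq> 0"
  proof
    assume "n = 0"
    then have "Re n = 0" by simp
    then have "u = 0"
      unfolding n_def by (auto simp: sum_2 vec_eq_iff forall_2 complex_eq_iff simp flip: power2_eq_square)
          (smt (verit) zero_le_power2 power2_less_eq_zero_iff)+
    with u show False by simp
  qed
  define P :: "complex^2^2" where "P = (\<chi> i j. u $ i * cnj (u $ j) / n)"
  have Pv: "P *v w = ((\<Sum>i\<in>UNIV. cnj (u $ i) * w $ i) / n) *s u" for w
    by (simp add: P_def matrix_vector_mult_def vec_eq_iff sum_2 field_simps n0)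
  have Pu: "P *v u = u" by (simp add: Pv n_def[symmetric] n0)
  have "self_adjoint P"
    by (simp add: self_adjoint_def adjoint_matrix_def P_def vec_eq_iff n_real)
  moreover have "P ** P = P"
  proof -
    have "P *v (P *v w) = P *v w" for w by (simp only: Pv[of w] mult_smult Pu)
    then show ?thesis by (simp add: matrix_eq flip: matrix_vector_mul_assoc)
  qed
  moreover have "range ((*v) P) = eigenspace A e"
  proof
    show "range ((*v) P) \<subseteq> eigenspace A e"
      using u(1) by (auto simp: Pv eigenspace_def mult_smult vector_smult_assoc mult.commute)
    show "eigenspace A e \<subseteq> range ((*v) P)"
    proof
      fix w assume w: "w \<in> eigenspace A e"
      obtain c d where cd: "w = c *s u + d *s v" using eigenvectors_span[OF u v e] by blast
      have "A *v w = c *s (e *s u) + d *s (e' *s v)"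
        using u(1) v(1) by (simp add: cd eigenspace_def matrix_vector_right_distrib mult_smult)
      moreover have "A *v w = e *s w" using w by (simp add: eigenspace_def)
      ultimately have eq: "c *s (e *s u) + d *s (e' *s v) = e *s (c *s u + d *s v)"
        by (simp only: cd)
      have "d * (e' - e) * v $ i = 0" for i
        using arg_cong[OF eq, of "\<lambda>x. x $ i"] by (simp add: algebra_simps del: mult_eq_0_iff)
      then have "d = 0" using e v(2) by (auto simp: vec_eq_iff)
      then have "w = P *v (c *s u)" using cd by (simp add: mult_smult Pu)
      then show "w \<in> range ((*v) P)" by blast
    qed
  qed
  moreover have "e \<in> eigenvalues A" using u by (auto simp: eigenvalues_def)
  ultimately show ?thesis unfolding spectral_projection_def by blast
qed

lemma pvm_information_eq:
  fixes \<rho>0 \<rho>1 A P :: "complex^2^2"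
  assumes "density_operator \<rho>0" "density_operator \<rho>1" "0 < a" "a < 1"
    and "self_adjoint A" "spectral_projection A P"
  shows "pvm_information a \<rho>0 \<rho>1 A =
    binary_entropy (a * born \<rho>0 P + (1 - a) * born \<rho>1 P)
      - a * binary_entropy (born \<rho>0 P) - (1 - a) * binary_entropy (born \<rho>1 P)"
proof -
  define Q where "Q = (SOME Q. spectral_projection A Q)"
  have Q: "spectral_projection A Q"
    unfolding Q_def using assms(6) by (rule someI)
  have "born \<rho>0 Q \<in> {0..1}" "born \<rho>1 Q \<in> {0..1}"
    using Q assms(1,2) by (auto simp only: spectral_projection_def intro: born_mem)
  then have I: "pvm_information a \<rho>0 \<rho>1 A =
    binary_entropy (a * born \<rho>0 Q + (1 - a) * born \<rho>1 Q)
      - a * binary_entropy (born \<rho>0 Q) - (1 - a) * binary_entropy (born \<rho>1 Q)"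
    unfolding pvm_information_def Q_def[symmetric]
    by (intro letter_outcome_information_eq assms)
  have sym: "binary_entropy (1 - u) = binary_entropy u" for u
    by (simp add: binary_entropy_def algebra_simps)
  have c: "a * (1 - x) + (1 - a) * (1 - y) = 1 - (a * x + (1 - a) * y)" for x y :: real
    by (simp add: algebra_simps)
  from spectral_projection_unique[OF assms(5,6) Q] show ?thesis
  proof
    assume "Q = mat 1 - P"
    then show ?thesis
      using assms(1,2) by (simp add: I density_operator_def born_complement c sym)
  qed (simp add: I)
qed

lemma self_adjoint_nondegenerate:
  fixes A :: "complex^2^2"
  assumes A: "self_adjoint A" and ns: "\<not> scalar_operator A"
  shows "nondegenerate A"
proof -
  define x where "x = Re (A $ 1 $ 1)"
  define y where "y = Re (A $ 2 $ 2)"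
  define z where "z = A $ 1 $ 2"
  have adj: "A $ i $ j = cnj (A $ j $ i)" for i j
    using arg_cong[OF A[unfolded self_adjoint_def], of "\<lambda>M. M $ i $ j"]
    by (simp add: adjoint_matrix_def)
  have entries: "A $ 1 $ 1 = of_real x" "A $ 2 $ 2 = of_real y" "A $ 1 $ 2 = z" "A $ 2 $ 1 = cnj z"
    using arg_cong[OF adj[of 1 1], of Im] arg_cong[OF adj[of 2 2], of Im]
    by (simp_all add: complex_eq_iff x_def y_def z_def adj[of 2 1])
  have ev: "e \<in> eigenvalues A" if "v \<noteq> 0" "A $ 1 $ 1 * v $ 1 + A $ 1 $ 2 * v $ 2 = e * v $ 1"
    "A $ 2 $ 1 * v $ 1 + A $ 2 $ 2 * v $ 2 = e * v $ 2" for e and v :: "complex^2"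
  proof -
    have "A *v v = e *s v"
      using that(2,3) by (simp add: matrix_vector_mult_def vec_eq_iff forall_2 sum_2)
    with that(1) show ?thesis unfolding eigenvalues_def eigenspace_def by blast
  qed
  show ?thesis
  proof (cases "z = 0")
    case True
    have "x \<noteq> y"
    proof
      assume "x = y"
      then have "A = mat (of_real x)"
        using True entries by (simp add: vec_eq_iff forall_2 mat_def)
      with ns show False by (auto simp: scalar_operator_def)
    qed
    moreover have "of_real x \<in> eigenvalues A"
      by (rule ev[of "vector [1, 0]"]) (auto simp: entries True vec_eq_iff forall_2)
    moreover have "of_real y \<in> eigenvalues A"
      by (rule ev[of "vector [0, 1]"]) (auto simp: entries True vec_eq_iff forall_2)
    ultimately show ?thesis
      unfolding nondegenerate_def by (metis of_real_eq_iff)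
  next
    case False
    define s where "s = sqrt ((x - y)\<^sup>2 + 4 * (cmod z)\<^sup>2)"
    have "(x - y)\<^sup>2 + 4 * (cmod z)\<^sup>2 > 0" using False by (simp add: add_nonneg_pos)
    then have s: "s > 0" "s\<^sup>2 = (x - y)\<^sup>2 + 4 * (cmod z)\<^sup>2" by (auto simp: s_def)
    have root: "of_real e \<in> eigenvalues A" if e: "(e - x) * (e - y) = (cmod z)\<^sup>2" for e
    proof -
      define v :: "complex^2" where "v = vector [z, of_real (e - x)]"
      have v: "v $ 1 = z" "v $ 2 = of_real (e - x)" by (simp_all add: v_def)
      have "complex_of_real ((e - x) * (e - y)) = z * cnj z"
        by (simp only: e complex_norm_square)
      then have "A $ 2 $ 1 * v $ 1 + A $ 2 $ 2 * v $ 2 = of_real e * v $ 2"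
        by (simp add: entries v algebra_simps)
      moreover have "A $ 1 $ 1 * v $ 1 + A $ 1 $ 2 * v $ 2 = of_real e * v $ 1"
        by (simp add: entries v algebra_simps)
      moreover have "v \<noteq> 0" using v(1) False by auto
      ultimately show ?thesis by (intro ev)
    qed
    have "complex_of_real ((x + y + s) / 2) \<in> eigenvalues A"
      by (rule root) (use s(2) in \<open>simp add: field_simps power2_eq_square\<close>)
    moreover have "complex_of_real ((x + y - s) / 2) \<in> eigenvalues A"
      by (rule root) (use s(2) in \<open>simp add: field_simps power2_eq_square\<close>)
    moreover have "complex_of_real ((x + y + s) / 2) \<noteq> complex_of_real ((x + y - s) / 2)"
      unfolding of_real_eq_iff using s(1) by simp
    ultimately show ?thesis unfolding nondegenerate_def by blast
  qed
qed


lemma H_nondegenerate: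
  assumes \<rho>: "density_operator \<rho>0" "density_operator \<rho>1" "\<rho>0 \<noteq> \<rho>1"
  shows "self_adjoint (H \<rho>0 \<rho>1 l)" "nondegenerate (H \<rho>0 \<rho>1 l)"
proof -
  define \<Delta> where "\<Delta> = \<rho>0 - \<rho>1"
  define D where "D = Re (trace (\<Delta> ** \<Delta>))"
  have sa: "self_adjoint \<rho>0" "self_adjoint \<rho>1" and tr: "trace \<rho>0 = 1" "trace \<rho>1 = 1"
    using \<rho>(1,2) by (auto simp: density_operator_def positive_semidefinite_def)
  have lin: "self_adjoint (r *\<^sub>R A + t *\<^sub>R B)" if "self_adjoint A" "self_adjoint B"
    for r t and A B :: "complex^2^2"
    using that by (simp add: self_adjoint_def adjoint_matrix_def vec_eq_iff)
  have "self_adjoint (l *\<^sub>R omega_mu \<rho>0 \<rho>1 + (-1) *\<^sub>R (1 *\<^sub>R \<rho>0 + (-1) *\<^sub>R \<rho>1))"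
    unfolding omega_mu_def by (intro lin sa)
  then show adj: "self_adjoint (H \<rho>0 \<rho>1 l)" by (simp add: H_def algebra_simps)
  have tl: "Re (trace ((r *\<^sub>R A + t *\<^sub>R B) ** C)) = r * Re (trace (A ** C)) + t * Re (trace (B ** C))"
    for r t and A B C :: "complex^2^2"
    by (simp add: trace_def matrix_matrix_mult_def sum_2 algebra_simps)
  have adj\<Delta>: "\<Delta> $ i $ j = cnj (\<Delta> $ j $ i)" for i j
    using lin[OF sa, of 1 "-1"]
    by (simp add: \<Delta>_def self_adjoint_def adjoint_matrix_def vec_eq_iff)
  have \<Delta>21: "\<Delta> $ 2 $ 1 = cnj (\<Delta> $ 1 $ 2)" by (rule adj\<Delta>)
  have "Im (\<Delta> $ 1 $ 1) = 0" "Im (\<Delta> $ 2 $ 2) = 0"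
    using arg_cong[OF adj\<Delta>[of 1 1], of Im] arg_cong[OF adj\<Delta>[of 2 2], of Im] by simp_all
  with \<Delta>21 have D: "D = (cmod (\<Delta> $ 1 $ 1))\<^sup>2 + 2 * (cmod (\<Delta> $ 1 $ 2))\<^sup>2 + (cmod (\<Delta> $ 2 $ 2))\<^sup>2"
    unfolding D_def trace_def matrix_matrix_mult_def cmod_power2
    by (simp add: sum_2 power2_eq_square complex_eq_iff)
  have "D \<noteq> 0"
  proof
    assume "D = 0"
    then have "\<Delta> $ 1 $ 1 = 0 \<and> \<Delta> $ 1 $ 2 = 0 \<and> \<Delta> $ 2 $ 2 = 0"
      unfolding D by (smt (verit) zero_le_power2 norm_eq_zero power2_eq_iff power_zero_numeral zero_eq_power2)
    then have "\<Delta> = 0" using \<Delta>21 by (simp add: vec_eq_iff forall_2)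
    then show False using \<rho>(3) by (simp add: \<Delta>_def)
  qed
  have mu: "mu \<rho>0 \<rho>1 = - Re (trace (\<rho>1 ** \<Delta>)) / D"
    using \<open>D \<noteq> 0\<close> unfolding mu_def D_def \<Delta>_def
    by (simp add: matrix_diff_distrib trace_sub)
  have DD: "D = Re (trace (\<rho>0 ** \<Delta>)) - Re (trace (\<rho>1 ** \<Delta>))"
    unfolding D_def by (subst (1) \<Delta>_def) (simp add: matrix_diff_distrib trace_sub)
  have "Re (trace (omega_mu \<rho>0 \<rho>1 ** \<Delta>)) = mu \<rho>0 \<rho>1 * D + Re (trace (\<rho>1 ** \<Delta>))"
    unfolding omega_mu_def tl DD by (simp add: algebra_simps)
  also have "\<dots> = 0" using \<open>D \<noteq> 0\<close> by (simp add: mu)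
  finally have om: "Re (trace (omega_mu \<rho>0 \<rho>1 ** \<Delta>)) = 0" .
  have "H \<rho>0 \<rho>1 l = l *\<^sub>R omega_mu \<rho>0 \<rho>1 + (-1) *\<^sub>R \<Delta>"
    by (simp add: H_def \<Delta>_def)
  then have HD: "Re (trace (H \<rho>0 \<rho>1 l ** \<Delta>)) = - D"
    by (simp only: tl om) (simp add: D_def)
  have "\<not> scalar_operator (H \<rho>0 \<rho>1 l)"
  proof
    assume "scalar_operator (H \<rho>0 \<rho>1 l)"
    then obtain c where "H \<rho>0 \<rho>1 l = mat c" by (auto simp: scalar_operator_def)
    then have "trace (H \<rho>0 \<rho>1 l ** \<Delta>) = c * trace \<Delta>"
      by (simp add: trace_def matrix_matrix_mult_def sum_2 mat_def algebra_simps)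
    then show False using HD \<open>D \<noteq> 0\<close> tr by (simp add: \<Delta>_def trace_sub)
  qed
  with adj show "nondegenerate (H \<rho>0 \<rho>1 l)" by (rule self_adjoint_nondegenerate)
qed

end

(* In Bloch coordinates the measurement for lambda has the axis cos th * d + sin th * w, where d is the
   unit vector along rho0 - rho1, w the unit vector along the foot of the perpendicular from the origin
   to the line through the two states, and tan th is a negative multiple of lambda.  Hence
   I_TD is I(th) = e(m) - a e(u) - b e(v) with u, v, m = a u + b v of the form x cos th + h sin th and
   e' = - artanh.  As I(-pi/2) = I(pi/2) = 0, Rolle's theorem gives a critical angle, and it suffices
   that I'' < 0 at every critical angle: then all critical points are strict local maxima, so there is
   only one of them and I' has the required signs.

   For the second derivative put U = (1 + u)/(1 - u), and similarly V, N for v, m.  Being critical means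
   that, after a common rescaling, the three points (ln E, 1/(1 + E)), E = U, N, V, are collinear, and
   this turns all sums over u, v, m into products.  With |r_i| <= 1 the claim reduces to bounding the
   logarithmic mean of N and U (or of N and V, if N < 1) by (1 + 1/V)/2 (or (1 + 1/U)/2); the arithmetic
   mean already satisfies this bound, by collinearity. *)

theory Submission
  imports Defs "HOL-Real_Asymp.Real_Asymp"
begin

section \<open>A logarithmic inequality\<close>

text \<open>Each logarithmic term differentiates to \<open>(E + 1) / (1 - r + r * w * E)\<close>.
  Over a common denominator the difference of the terms for \<open>U\<close> and \<open>N\<close>
  contains the factor \<open>U - N\<close>, which cancels. The remaining numerator depends on
  \<open>r\<close> and \<open>w\<close> only, so different pairs \<open>U\<close>, \<open>N\<close>
  can be compared.\<close>

lemma log_quotient_difference_primitive: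
  fixes w U N :: real
  assumes "w > 0" "U > 0" "N > 0" "U \<noteq> N" "U * w \<noteq> 1" "N * w \<noteq> 1"
  defines "K \<equiv> \<lambda>r. ((U + 1) * ln (1 + r * (U * w - 1)) / (U * w - 1)
    - (N + 1) * ln (1 + r * (N * w - 1)) / (N * w - 1)) / (U - N)"
  assumes r: "0 \<le> r" "r \<le> 1"
  shows "(K has_real_derivative
    (1 - r - r * w) / ((1 - r + r * w * U) * (1 - r + r * w * N))) (at r)"
proof -
  have pos: "1 - r + r * w * E > 0" if "E > 0" for E
  proof (cases "r = 1")
    case False
    with r assms(1) that show ?thesis by (intro add_pos_nonneg) auto
  qed (use assms(1) that in simp)
  have eq: "1 + r * (E * w - 1) = 1 - r + r * w * E" for E by (simp add: algebra_simps)
  have p: "1 - r + r * w * U > 0" "1 - r + r * w * N > 0" using pos assms by auto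
  have ne: "U * w - 1 \<noteq> 0" "N * w - 1 \<noteq> 0" "U - N \<noteq> 0" using assms by auto
  have d: "((U + 1) / (1 - r + r * w * U) - (N + 1) / (1 - r + r * w * N)) / (U - N)
      = (1 - r - r * w) / ((1 - r + r * w * U) * (1 - r + r * w * N))"
    using p ne(3) by (simp add: divide_simps) (simp add: algebra_simps)
  have D: "((\<lambda>r. (E + 1) * ln (1 + r * (E * w - 1)) / (E * w - 1)) has_real_derivative
     (E + 1) / (1 - r + r * w * E)) (at r)" if "E * w - 1 \<noteq> 0" "1 - r + r * w * E > 0" for E
    by (rule derivative_eq_intros refl | use that in \<open>simp add: eq\<close>)+
  show ?thesis
    unfolding K_def d[symmetric]
    by (intro DERIV_cdivide DERIV_diff D ne p)
qed

text \<open>For fixed \<open>w\<close>, the function \<open>E \<mapsto> (E + 1) ln (E w) / (E w - 1)\<close> takes equal values at \<open>w\<close> and \<open>1\<close>.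
  Its difference quotient is the integral over \<open>r \<in> [0,1]\<close> of \<open>1 - r - r w\<close> divided by
  \<open>(1 - r + r w U) (1 - r + r w N)\<close>; if \<open>U + N > 1 + w\<close>, comparing that denominator with the one for
  \<open>U = w\<close>, \<open>N = 1\<close> shows that this integral is positive.\<close>

lemma log_quotient_sum_le:
  fixes w U N :: real
  assumes pos: "w > 0" "U > 0" "N > 0" and ne: "U \<noteq> N" "U * w \<noteq> 1" "N * w \<noteq> 1"
    and side: "(U - 1) * (N - 1) \<ge> 0"
    and eq: "(U + 1) * ln (U * w) / (U * w - 1) = (N + 1) * ln (N * w) / (N * w - 1)"
  shows "U + N \<le> 1 + w"
proof (rule ccontr)
  assume "\<not> U + N \<le> 1 + w"
  then have S: "U + N > 1 + w" by simp
  from side have P: "U * N \<ge> U + N - 1" by (simp add: algebra_simps)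
  with S have Pw: "U * N > w" by simp
  \<comment> \<open>With this constant the polynomial \<open>e r - C * d r\<close> below is
    divisible by \<open>n r\<close>: the remainder, a multiple of \<open>(1 - r) * (r * w)\<close>,
    vanishes.\<close>
  define C where "C = 2 * (1 + w) / ((1 + U) * (1 + N))"
  have C0: "C > 0" using pos by (simp add: C_def)
  have Cmul: "C * (1 + U + N + U * N) = 2 * (1 + w)"
  proof -
    have "1 + U + N + U * N = (1 + U) * (1 + N)" by (simp add: algebra_simps)
    then show ?thesis using pos by (simp add: C_def)
  qed
  have C1: "C < 1"
    using pos S P by (simp add: C_def field_simps)
  have C2: "C * (U * N) \<ge> w"
  proof -
    have "w * (1 + U + N + U * N) \<le> 2 * (1 + w) * (U * N)"
      using mult_left_mono[OF P, of w] Pw pos(1) by (simp add: algebra_simps)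
    also have "\<dots> = C * (U * N) * (1 + U + N + U * N)"
      unfolding Cmul[symmetric] by (simp add: algebra_simps)
    finally have "w * (1 + U + N + U * N) \<le> C * (U * N) * (1 + U + N + U * N)" .
    moreover have "1 + U + N + U * N > 0" using pos by (simp add: add_pos_pos)
    ultimately show ?thesis by (rule mult_right_le_imp_le)
  qed
  \<comment> \<open>\<open>d\<close> is the denominator for the pair \<open>U\<close>,
    \<open>N\<close>, and \<open>e\<close> the one for the comparison pair \<open>w\<close>,
    \<open>1\<close>. The numerator \<open>n\<close> is common to both and changes sign at
    \<open>1 / (1 + w)\<close>.\<close>
  define n where "n = (\<lambda>r::real. 1 - r - r * w)"
  define d where "d = (\<lambda>r::real. (1 - r + r * w * U) * (1 - r + r * w * N))"
  define e where "e = (\<lambda>r::real. (1 - r + r * w * w) * (1 - r + r * w * 1))"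
  have lpos: "1 - r + r * w * E > 0" if "E > 0" "0 \<le> r" "r \<le> 1" for E r
  proof (cases "r = 1")
    case False
    with that pos(1) show ?thesis by (intro add_pos_nonneg) auto
  qed (use pos(1) that in simp)
  have dpos: "d r > 0" and epos: "e r > 0" if "0 \<le> r" "r \<le> 1" for r
    unfolding d_def e_def by (intro mult_pos_pos lpos that pos zero_less_one)+
  have "\<exists>K. K 0 = 0 \<and> K 1 = 0 \<and> (\<forall>r. 0 \<le> r \<longrightarrow> r \<le> 1 \<longrightarrow> (K has_real_derivative n r / e r) (at r))"
  proof (cases "w = 1")
    \<comment> \<open>The pair \<open>w\<close>, \<open>1\<close> has collapsed, so there is no
      difference quotient to form. But \<open>e\<close> is constantly 1, and
      \<open>n r = 1 - 2 * r\<close> has the primitive \<open>r - r * r\<close>.\<close>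
    case True
    show ?thesis
      by (rule exI[of _ "\<lambda>r. r - r * r"]) (auto simp: True n_def e_def intro!: derivative_eq_intros)
  next
    case False
    have w: "w * w \<noteq> 1"
    proof
      assume "w * w = 1"
      then have "(w - 1) * (w + 1) = 0" by (simp add: algebra_simps)
      with False pos(1) show False by simp
    qed
    define K where "K = (\<lambda>r. ((w + 1) * ln (1 + r * (w * w - 1)) / (w * w - 1)
      - (1 + 1) * ln (1 + r * (1 * w - 1)) / (1 * w - 1)) / (w - 1))"
    have f: "w * w - 1 = (w + 1) * (w - 1)" by (simp add: algebra_simps)
    have "(w + 1) * ln (w * w) / (w * w - 1) = 2 * ln w / (w - 1)"
    proof -
      have "ln (w * w) = 2 * ln w" using pos by (simp add: ln_mult)
      then show ?thesis
        unfolding f using pos by (simp only:) (subst mult_divide_mult_cancel_left, simp_all)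
    qed
    then have "K 1 = 0" by (simp add: K_def)
    moreover have "K 0 = 0" by (simp add: K_def)
    moreover have "(K has_real_derivative n r / e r) (at r)" if "0 \<le> r" "r \<le> 1" for r
      using log_quotient_difference_primitive[of w w 1 r] False w pos that
      by (simp add: K_def n_def e_def)
    ultimately show ?thesis by blast
  qed
  then obtain K where K: "K 0 = 0" "K 1 = 0"
    "\<And>r. 0 \<le> r \<Longrightarrow> r \<le> 1 \<Longrightarrow> (K has_real_derivative n r / e r) (at r)"
    by blast
  define J where "J = (\<lambda>r. ((U + 1) * ln (1 + r * (U * w - 1)) / (U * w - 1)
    - (N + 1) * ln (1 + r * (N * w - 1)) / (N * w - 1)) / (U - N))"
  have J: "J 0 = 0" "J 1 = 0"
    "\<And>r. 0 \<le> r \<Longrightarrow> r \<le> 1 \<Longrightarrow> (J has_real_derivative n r / d r) (at r)"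
    using eq log_quotient_difference_primitive[OF pos(1,2,3) ne]
    unfolding J_def n_def d_def by simp_all
  define F where "F = (\<lambda>r. J r - C * K r)"
  have F: "(F has_real_derivative n r / d r - C * (n r / e r)) (at r)" if "0 \<le> r" "r \<le> 1" for r
    unfolding F_def by (intro DERIV_diff DERIV_cmult J K that)
  \<comment> \<open>The numerator \<open>n r * (e r - C * d r)\<close> becomes
    \<open>(n r)\<^sup>2\<close> times a weight that \<open>C1\<close> and \<open>C2\<close> make
    nonnegative, so the sign change of \<open>n\<close> does no harm.\<close>
  have id: "n r / d r - C * (n r / e r) = (n r)\<^sup>2 * ((1 - C) * (1 - r) + (C * (U * N) - w) * (r * w)) / (d r * e r)"
    if "0 \<le> r" "r \<le> 1" for r
  proof -
    have "e r - C * d r = n r * ((1 - C) * (1 - r) + (C * (U * N) - w) * (r * w))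
        + (1 - r) * (r * w) * (2 * (1 + w) - C * (1 + U + N + U * N))"
      unfolding n_def d_def e_def by algebra
    then have "e r - C * d r = n r * ((1 - C) * (1 - r) + (C * (U * N) - w) * (r * w))"
      by (simp add: Cmul)
    then have "(n r)\<^sup>2 * ((1 - C) * (1 - r) + (C * (U * N) - w) * (r * w)) = n r * (e r - C * d r)"
      by (simp add: power2_eq_square)
    then show ?thesis
      using dpos[OF that] epos[OF that] by (simp add: field_simps)
  qed
  have nonneg: "n r / d r - C * (n r / e r) \<ge> 0" if "0 \<le> r" "r \<le> 1" for r
    unfolding id[OF that] using that C1 C2 pos dpos[OF that] epos[OF that]
    by (intro divide_nonneg_pos mult_nonneg_nonneg add_nonneg_nonneg) auto
  have strict: "n r / d r - C * (n r / e r) > 0" if "0 \<le> r" "r \<le> 1" "r < 1 / (1 + w)" for r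
  proof -
    have "r < 1" using that pos by (simp add: field_simps) (smt (verit) mult_nonneg_nonneg)
    have "n r > 0" using that pos by (simp add: n_def field_simps)
    moreover have "(1 - C) * (1 - r) + (C * (U * N) - w) * (r * w) > 0"
      using \<open>r < 1\<close> C1 C2 pos that by (intro add_pos_nonneg) auto
    ultimately show ?thesis
      unfolding id[OF that(1,2)] using dpos[OF that(1,2)] epos[OF that(1,2)]
      by (intro divide_pos_pos mult_pos_pos) auto
  qed
  \<comment> \<open>A point strictly between 0 and the zero of \<open>n\<close>. \<open>F\<close>
    increases strictly up to \<open>t\<close> and does not decrease afterwards, although it vanishes
    at 0 and at 1.\<close>
  define t where "t = 1 / (2 + w)"
  have t: "0 < t" "t < 1" "t < 1 / (1 + w)"
    using pos by (auto simp: t_def field_simps)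
  have "F 0 < F t"
  proof (rule DERIV_pos_imp_increasing[of 0 t F])
    show "\<exists>y. (F has_real_derivative y) (at r) \<and> 0 < y" if "0 \<le> r" "r \<le> t" for r
      using F[of r] strict[of r] t that by (meson less_imp_le order_trans order_le_less_trans)
  qed (rule t)
  moreover have "F t \<le> F 1"
  proof (rule DERIV_nonneg_imp_nondecreasing[of t 1 F])
    show "\<exists>y. (F has_real_derivative y) (at r) \<and> 0 \<le> y" if "t \<le> r" "r \<le> 1" for r
      using F[of r] nonneg[of r] t that by (meson less_imp_le order_trans)
  qed (use t in simp)
  ultimately show False using J(1,2) K(1,2) by (simp add: F_def)
qed

text \<open>The quotient is the reciprocal of the logarithmic mean, which lies between
  \<open>y\<close> and \<open>x\<close> and below the arithmetic mean. For \<open>z = x / y\<close>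
  the latter is \<open>ln z > 2 * (z - 1) / (z + 1)\<close>: the two sides agree at 1, and their
  difference has the derivative \<open>(t - 1)\<^sup>2 / (t * (t + 1)\<^sup>2)\<close>.\<close>

lemma log_mean_bounds:
  fixes x y :: real
  assumes "0 < y" "y < x"
  shows "2 / (x + y) < (ln x - ln y) / (x - y)" "1 / x < (ln x - ln y) / (x - y)"
    "(ln x - ln y) / (x - y) < 1 / y"
proof -
  define z where "z = x / y"
  have z: "1 < z" using assms by (simp add: z_def)
  define f where "f = (\<lambda>z::real. ln z - 2 * (z - 1) / (z + 1))"
  have d: "(f has_real_derivative 1 / t - 4 / (t + 1)\<^sup>2) (at t)" if "0 < t" for t
    unfolding f_def
    by (rule derivative_eq_intros refl | use that in \<open>simp add: field_simps power2_eq_square\<close>)+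
  have "f 1 < f z"
  proof (rule DERIV_pos_imp_increasing_open[OF z])
    fix t :: real assume t: "1 < t" "t < z"
    have "1 / t - 4 / (t + 1)\<^sup>2 = (t - 1)\<^sup>2 / (t * (t + 1)\<^sup>2)"
      using t by (simp add: divide_simps) (simp add: power2_eq_square algebra_simps)
    also have "\<dots> > 0" using t by simp
    finally show "\<exists>y. (f has_real_derivative y) (at t) \<and> 0 < y"
      using d[of t] t by (intro exI[of _ "1 / t - 4 / (t + 1)\<^sup>2"]) simp
  next
    show "continuous_on {1..z} f"
      unfolding f_def by (auto intro!: continuous_intros)
  qed
  then have 1: "2 * (z - 1) / (z + 1) < ln z" by (simp add: f_def)
  have "2 * (z - 1) / (z + 1) = 2 * (x - y) / (x + y)"
  proof -
    have "z - 1 = (x - y) / y" "z + 1 = (x + y) / y"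
      using assms by (simp_all add: z_def field_simps)
    then show ?thesis using assms by simp
  qed
  with 1 have *: "2 * (x - y) / (x + y) < ln x - ln y"
    using assms by (simp add: z_def ln_div)
  with assms show A: "2 / (x + y) < (ln x - ln y) / (x - y)"
    by (simp add: field_simps)
  have "1 / x < 2 / (x + y)" using assms by (simp add: field_simps)
  with A show "1 / x < (ln x - ln y) / (x - y)" by simp
  have "ln z < z - 1"
    using ln_le_minus_one[of z] ln_eq_minus_one[of z] z by fastforce
  then show "(ln x - ln y) / (x - y) < 1 / y"
    using assms by (simp add: z_def ln_div field_simps)
qed

text \<open>Hypothesis \<open>eq\<close> expresses that the points (ln E, 1/(1 + E)) for E =
  \<open>U\<close>, \<open>N\<close>, \<open>V\<close> are collinear. Collinearity and
  \<open>side\<close> survive the passage to reciprocals, so \<open>log_quotient_sum_le\<close>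
  applies to \<open>U\<close>, \<open>N\<close> with \<open>w = 1 / V\<close> and to
  \<open>1 / U\<close>, \<open>1 / N\<close> with \<open>w = V\<close>.\<close>

lemma collinear_log_sum_le:
  fixes U N V :: real
  assumes pos: "U > 0" "N > 0" "V > 0" and ne: "U \<noteq> N" "U \<noteq> V" "N \<noteq> V"
    and side: "(U - 1) * (N - 1) \<ge> 0"
    and eq: "(U + 1) * (ln U - ln V) * (N - V) = (N + 1) * (ln N - ln V) * (U - V)"
  shows "U + N \<le> 1 + 1 / V" "1 / U + 1 / N \<le> 1 + V"
proof -
  have eq': "(U + 1) * (ln U - ln V) / (U - V) = (N + 1) * (ln N - ln V) / (N - V)"
    using eq ne by (simp add: divide_simps)
  have 1: "(E + 1) * ln (E * (1 / V)) / (E * (1 / V) - 1) = V * ((E + 1) * (ln E - ln V) / (E - V))"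
    if "E > 0" "E \<noteq> V" for E
    using that pos by (simp add: ln_div divide_simps)
  have 2: "(1 / E + 1) * ln (1 / E * V) / (1 / E * V - 1) = (E + 1) * (ln E - ln V) / (E - V)"
    if "E > 0" "E \<noteq> V" for E
    using that pos by (simp add: ln_div divide_simps) (simp add: algebra_simps)
  have ne': "U * (1 / V) \<noteq> 1" "N * (1 / V) \<noteq> 1" "1 / U * V \<noteq> 1" "1 / N * V \<noteq> 1"
    using pos ne by auto
  have e1: "(U + 1) * ln (U * (1 / V)) / (U * (1 / V) - 1) = (N + 1) * ln (N * (1 / V)) / (N * (1 / V) - 1)"
    unfolding 1[OF pos(1) ne(2)] 1[OF pos(2) ne(3)] eq' by (rule refl)
  show "U + N \<le> 1 + 1 / V"
    by (rule log_quotient_sum_le[OF _ pos(1,2) ne(1) ne'(1,2) side e1]) (use pos in simp)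
  have "(1 / U - 1) * (1 / N - 1) = (U - 1) * (N - 1) / (U * N)"
    using pos by (simp add: field_simps)
  also have "\<dots> \<ge> 0" using pos side by simp
  finally have side': "(1 / U - 1) * (1 / N - 1) \<ge> 0" .
  have e2: "(1 / U + 1) * ln (1 / U * V) / (1 / U * V - 1) = (1 / N + 1) * ln (1 / N * V) / (1 / N * V - 1)"
    unfolding 2[OF pos(1) ne(2)] 2[OF pos(2) ne(3)] eq' by (rule refl)
  show "1 / U + 1 / N \<le> 1 + V"
    by (rule log_quotient_sum_le[OF pos(3) _ _ _ ne'(3,4) side' e2]) (use pos ne in simp_all)
qed

text \<open>Here \<open>l\<close> stands for the reciprocal logarithmic mean of \<open>E\<close> and
  \<open>N\<close>. Both left-hand sides are at most \<open>4 / (E + N)\<close>: the first by the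
  bound on \<open>E + N\<close>, the second by the bound on \<open>1 / E + 1 / N\<close>.\<close>

lemma log_bound_of_reciprocal_sums:
  fixes E N W c l :: real
  assumes pos: "E > 0" "N > 0" "W > 0" and l: "2 / (E + N) < l"
    and le: "E + N \<le> 1 + 1 / W" "1 / E + 1 / N \<le> 1 + W"
    and c: "c * (1 + W)\<^sup>2 \<le> 4 * W"
  shows "c * (1 + W) < 2 * l" "c * (1 + W) / (E * W * N) < 2 * l"
proof -
  have c': "c * (1 + W) \<le> 4 * W / (1 + W)"
    using c pos by (simp add: field_simps power2_eq_square)
  have "2 * W / (1 + W) = 2 / (1 + 1 / W)" using pos by (simp add: field_simps)
  also have "\<dots> \<le> 2 / (E + N)" using le pos by (intro divide_left_mono) (auto simp: add_pos_pos)
  finally show "c * (1 + W) < 2 * l" using c' l by simp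
  have "c * (1 + W) / (E * W * N) \<le> 4 * W / (1 + W) / (E * W * N)"
    using c' pos by (intro divide_right_mono) auto
  also have "\<dots> = 4 / ((1 + W) * (E * N))" using pos by (simp add: divide_simps)
  also have "\<dots> \<le> 4 / (E + N)"
  proof (intro divide_left_mono)
    have "E + N = (1 / E + 1 / N) * (E * N)" using pos by (simp add: field_simps)
    also have "\<dots> \<le> (1 + W) * (E * N)" using le pos by (intro mult_right_mono) auto
    finally show "E + N \<le> (1 + W) * (E * N)" .
  qed (use pos in auto)
  finally show "c * (1 + W) / (E * W * N) < 2 * l" using l by simp
qed

text \<open>The normalised form of the curvature inequality, in which the velocities are
  proportional to 1 + E. That the two expressions for \<open>q\<close> agree is again collinearity
  of the points (ln E, 1/(1 + E)).\<close>

lemma collinear_log_inequality: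
  fixes U N V \<alpha> \<beta> q :: real
  assumes ord: "0 < V" "V < N" "N < U" and ab: "\<alpha> > 0" "\<beta> > 0"
    and q: "q = (1 + U) * ((ln U - ln N) / (U - N))" "q = (1 + V) * ((ln N - ln V) / (N - V))"
    and c: "\<alpha> * \<beta> * (1 + U)\<^sup>2 \<le> 4 * U" "\<alpha> * \<beta> * (1 + V)\<^sup>2 \<le> 4 * V"
  shows "\<alpha> * \<beta> * (\<beta> + \<alpha> / (U * V * N)) * ((1 + U) * (1 + V)) < 2 * (\<alpha> + \<beta>) * q"
proof -
  have pos: "U > 0" "N > 0" using ord by auto
  have det: "(N - V) * (1 + U) * (ln U - ln N) = (U - N) * (1 + V) * (ln N - ln V)"
    using trans[OF q(1)[symmetric] q(2)] ord by (simp add: field_simps)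
  have det1: "(U + 1) * (ln U - ln V) * (N - V) = (N + 1) * (ln N - ln V) * (U - V)"
    and det2: "(V + 1) * (ln V - ln U) * (N - U) = (N + 1) * (ln N - ln U) * (V - U)"
    using det by (simp_all add: algebra_simps)
  \<comment> \<open>The goal is \<beta> times the first of these inequalities plus \<alpha> times
    the second.\<close>
  have "\<alpha> * \<beta> * ((1 + U) * (1 + V)) < 2 * q \<and> \<alpha> * \<beta> * ((1 + U) * (1 + V)) / (U * V * N) < 2 * q"
  \<comment> \<open>\<open>collinear_log_sum_le\<close> wants two points on the same side of 1:
    \<open>U\<close> and \<open>N\<close> if \<open>N \<ge> 1\<close>, and \<open>V\<close> and
    \<open>N\<close> otherwise.\<close>
  proof (cases "N \<ge> 1")
    case True
    have "(U - 1) * (N - 1) \<ge> 0" using True ord by simp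
    then have "U + N \<le> 1 + 1 / V" "1 / U + 1 / N \<le> 1 + V"
      using collinear_log_sum_le[OF pos ord(1) _ _ _ _ det1] ord by auto
    from log_bound_of_reciprocal_sums[OF pos ord(1) log_mean_bounds(1)[OF pos(2) ord(3)] this c(2)]
    have "\<alpha> * \<beta> * (1 + V) < 2 * ((ln U - ln N) / (U - N))"
      "\<alpha> * \<beta> * (1 + V) / (U * V * N) < 2 * ((ln U - ln N) / (U - N))" .
    from this[THEN mult_strict_left_mono, of "1 + U"] show ?thesis
      using pos unfolding q(1) by (simp add: mult_ac)
  next
    case False
    have "(V - 1) * (N - 1) \<ge> 0" using False ord by (simp add: mult_nonpos_nonpos)
    then have "V + N \<le> 1 + 1 / U" "1 / V + 1 / N \<le> 1 + U"
      using collinear_log_sum_le[OF ord(1) pos(2,1) _ _ _ _ det2] ord by auto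
    moreover have "2 / (V + N) < (ln N - ln V) / (N - V)"
      using log_mean_bounds(1)[OF ord(1,2)] by (simp add: add.commute)
    ultimately have "\<alpha> * \<beta> * (1 + U) < 2 * ((ln N - ln V) / (N - V))"
      "\<alpha> * \<beta> * (1 + U) / (V * U * N) < 2 * ((ln N - ln V) / (N - V))"
      using log_bound_of_reciprocal_sums[of V N U] c(1) pos ord(1) by blast+
    from this[THEN mult_strict_left_mono, of "1 + V"] show ?thesis
      using ord unfolding q(2) by (simp add: mult_ac)
  qed
  then have "\<beta> * (\<alpha> * \<beta> * ((1 + U) * (1 + V))) < \<beta> * (2 * q)"
    "\<alpha> * (\<alpha> * \<beta> * ((1 + U) * (1 + V)) / (U * V * N)) < \<alpha> * (2 * q)"
    using mult_strict_left_mono ab by blast+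
  moreover have "\<alpha> * \<beta> * (\<beta> + \<alpha> / (U * V * N)) * ((1 + U) * (1 + V))
    = \<beta> * (\<alpha> * \<beta> * ((1 + U) * (1 + V))) + \<alpha> * (\<alpha> * \<beta> * ((1 + U) * (1 + V)) / (U * V * N))"
    by (simp add: algebra_simps)
  moreover have "2 * (\<alpha> + \<beta>) * q = \<beta> * (2 * q) + \<alpha> * (2 * q)" by (simp add: algebra_simps)
  ultimately show ?thesis by linarith
qed

section \<open>Curvature at a critical point\<close>

text \<open>By the bounds on the logarithmic mean, \<open>U * k > 1 > V * l\<close> and
  \<open>l > 1 / N > k\<close>. Criticality reads
  \<open>\<alpha> * (U * k - V * l) = \<beta> * (l - k)\<close> with both brackets positive, so
  \<alpha> and \<beta> share the sign of their sum.\<close>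

lemma critical_slopes_pos:
  fixes U N V \<alpha> \<beta> :: real
  assumes ord: "0 < V" "V < N" "N < U" and ab: "\<alpha> + \<beta> > 0"
    and crit: "(\<alpha> * U + \<beta>) * ((ln U - ln N) / (U - N)) = (\<alpha> * V + \<beta>) * ((ln N - ln V) / (N - V))"
  shows "\<alpha> > 0" "\<beta> > 0"
proof -
  define k where "k = (ln U - ln N) / (U - N)"
  define l where "l = (ln N - ln V) / (N - V)"
  have k: "1 / U < k" "k < 1 / N" and l: "1 / N < l" "l < 1 / V"
    using log_mean_bounds[of N U] log_mean_bounds[of V N] ord by (simp_all add: k_def l_def)
  have "V * l < 1" "1 < U * k" using k l ord by (simp_all add: field_simps)
  then have x: "U * k - V * l > 0" by simp
  have y: "l - k > 0" using k l by simp
  have eq: "\<alpha> * (U * k - V * l) = \<beta> * (l - k)"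
    using crit unfolding k_def[symmetric] l_def[symmetric] by (simp add: algebra_simps)
  show "\<alpha> > 0"
  proof (rule ccontr)
    assume "\<not> \<alpha> > 0"
    then have "\<beta> * (l - k) \<le> 0" using x by (simp flip: eq add: mult_nonpos_nonneg)
    with y have "\<beta> \<le> 0" by (simp add: mult_le_0_iff)
    with \<open>\<not> \<alpha> > 0\<close> ab show False by simp
  qed
  with x have "\<beta> * (l - k) > 0" by (simp flip: eq)
  with y show "\<beta> > 0" by (simp add: zero_less_mult_iff)
qed

text \<open>Scaling \<open>U\<close>, \<open>N\<close>, \<open>V\<close> by
  \<open>t = \<alpha> / \<beta>\<close> turns \<open>\<alpha> * E + \<beta>\<close> into
  \<open>\<beta> * (1 + t * E)\<close>, makes \<open>crit\<close> the collinearity condition for the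
  scaled points, and makes \<open>c\<close> the bounds required by
  \<open>collinear_log_inequality\<close>.\<close>

lemma critical_curvature_inequality:
  fixes U N V \<alpha> \<beta> :: real
  assumes ord: "0 < V" "V < N" "N < U" and ab: "\<alpha> + \<beta> > 0"
    and crit: "(\<alpha> * U + \<beta>) * ((ln U - ln N) / (U - N)) = (\<alpha> * V + \<beta>) * ((ln N - ln V) / (N - V))"
    and c: "(\<alpha> * U + \<beta>)\<^sup>2 \<le> 4 * U" "(\<alpha> * V + \<beta>)\<^sup>2 \<le> 4 * V"
  shows "(\<alpha>\<^sup>2 + \<beta>\<^sup>2 / (U * V * N)) * (\<alpha> * V + \<beta>) < 2 * (\<alpha> + \<beta>) * ((ln U - ln N) / (U - N))"
proof -
  note pos = critical_slopes_pos[OF ord ab crit]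
  define t where "t = \<alpha> / \<beta>"
  have t: "t > 0" using pos by (simp add: t_def)
  define k where "k = (ln U - ln N) / (U - N)"
  define l where "l = (ln N - ln V) / (N - V)"
  define q where "q = (1 + t * U) * (k / t)"
  have at: "\<alpha> = t * \<beta>" using pos by (simp add: t_def)
  have lin: "\<alpha> * E + \<beta> = \<beta> * (1 + t * E)" for E by (simp add: at algebra_simps)
  have crit': "(1 + t * U) * k = (1 + t * V) * l"
    using crit pos unfolding lin k_def[symmetric] l_def[symmetric] by simp
  have quot: "(ln (t * x) - ln (t * y)) / (t * x - t * y) = (ln x - ln y) / (x - y) / t"
    if "0 < x" "0 < y" for x y
  proof -
    have "t * x - t * y = (x - y) * t" by (simp add: algebra_simps)
    then show ?thesis using that t by (simp add: ln_mult)
  qed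
  have b: "\<alpha> * \<beta> * (1 + t * E)\<^sup>2 \<le> 4 * (t * E)" if "(\<alpha> * E + \<beta>)\<^sup>2 \<le> 4 * E" for E
  proof -
    have "t * (\<alpha> * E + \<beta>)\<^sup>2 \<le> t * (4 * E)" using that t by (intro mult_left_mono) auto
    then show ?thesis by (simp add: lin at power2_eq_square algebra_simps)
  qed
  have "\<alpha> * \<beta> * (\<beta> + \<alpha> / (t * U * (t * V) * (t * N))) * ((1 + t * U) * (1 + t * V)) < 2 * (\<alpha> + \<beta>) * q"
  proof (rule collinear_log_inequality)
    show "q = (1 + t * U) * ((ln (t * U) - ln (t * N)) / (t * U - t * N))"
      using ord by (simp add: quot q_def k_def)
    show "q = (1 + t * V) * ((ln (t * N) - ln (t * V)) / (t * N - t * V))"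
      using ord crit' by (simp add: quot q_def l_def)
  qed (use ord t pos b c in auto)
  also have "\<alpha> * \<beta> * (\<beta> + \<alpha> / (t * U * (t * V) * (t * N))) * ((1 + t * U) * (1 + t * V))
      = (1 + t * U) / t * ((\<alpha>\<^sup>2 + \<beta>\<^sup>2 / (U * V * N)) * (\<alpha> * V + \<beta>))"
  proof -
    have "\<alpha> * \<beta> * (\<beta> + \<alpha> / (t * U * (t * V) * (t * N))) = (\<alpha>\<^sup>2 + \<beta>\<^sup>2 / (U * V * N)) * \<beta> / t"
      unfolding at using t ord by (simp add: field_simps power2_eq_square)
    then show ?thesis by (simp add: lin)
  qed
  also have "2 * (\<alpha> + \<beta>) * q = (1 + t * U) / t * (2 * (\<alpha> + \<beta>) * k)" by (simp add: q_def)
  finally have "(1 + t * U) / t * ((\<alpha>\<^sup>2 + \<beta>\<^sup>2 / (U * V * N)) * (\<alpha> * V + \<beta>))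
      < (1 + t * U) / t * (2 * (\<alpha> + \<beta>) * k)" .
  moreover have "(1 + t * U) / t \<ge> 0" using t ord by simp
  ultimately show ?thesis unfolding k_def by (rule mult_left_less_imp_less)
qed

text \<open>\<open>du\<close>, \<open>dv\<close>, \<open>dm\<close> are the velocities of
  \<open>u\<close>, \<open>v\<close>, \<open>m\<close> under rotation of the axis: values of one
  affine function, equal to \<alpha> at 1 and to \<beta> at -1. \<open>crit\<close> says that the
  first derivative of the information vanishes, and the conclusion that the second is negative. The
  substitution \<open>e\<close> turns \<open>artanh\<close> into half a logarithm.\<close>

lemma artanh_curvature_at_critical_point:
  fixes u v m a b \<alpha> \<beta> :: real
  defines "du \<equiv> ((1 + u) * \<alpha> + (1 - u) * \<beta>) / 2" and "dv \<equiv> ((1 + v) * \<alpha> + (1 - v) * \<beta>) / 2"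
    and "dm \<equiv> ((1 + m) * \<alpha> + (1 - m) * \<beta>) / 2"
  assumes uv: "-1 < v" "v < u" "u < 1" and ab: "a > 0" "b > 0" "a + b = 1"
    and m: "m = a * u + b * v" and pos: "\<alpha> + \<beta> > 0"
    and c: "du\<^sup>2 \<le> 1 - u\<^sup>2" "dv\<^sup>2 \<le> 1 - v\<^sup>2"
    and crit: "a * du * (artanh u - artanh m) + b * dv * (artanh v - artanh m) = 0"
  shows "a * (du\<^sup>2 / (1 - u\<^sup>2) - u * artanh u) + b * (dv\<^sup>2 / (1 - v\<^sup>2) - v * artanh v)
    < dm\<^sup>2 / (1 - m\<^sup>2) - m * artanh m"
proof -
  define e where "e = (\<lambda>x::real. (1 + x) / (1 - x))"
  define U where "U = e u"
  define V where "V = e v"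
  define N where "N = e m"
  have mv: "m - v = a * (u - v)" and um: "u - m = b * (u - v)"
    unfolding m using ab(3) by algebra+
  have "a * (u - v) > 0" "b * (u - v) > 0" using ab uv by simp_all
  with mv um have vm: "v < m" "m < u" by linarith+
  have mono: "e x < e y" if "x < y" "y < 1" for x y
    using that by (simp add: e_def field_simps)
  have ord: "0 < V" "V < N" "N < U"
    using uv vm mono by (auto simp: U_def V_def N_def) (simp add: e_def)
  have e1: "x = (e x - 1) / (e x + 1)" "1 - x = 2 / (e x + 1)" "1 + x = 2 * e x / (e x + 1)" if "x < 1" for x
  proof -
    have "e x + 1 = 2 / (1 - x)" "e x - 1 = 2 * x / (1 - x)" using that by (simp_all add: e_def field_simps)
    then show "x = (e x - 1) / (e x + 1)" "1 - x = 2 / (e x + 1)" "1 + x = 2 * e x / (e x + 1)"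
      using that by (simp_all add: e_def)
  qed
  note xu = e1[OF uv(3), folded U_def]
  have xv: "v = (V - 1) / (V + 1)" "1 - v = 2 / (V + 1)" "1 + v = 2 * V / (V + 1)"
    using e1[of v] uv by (simp_all add: V_def)
  have xm: "m = (N - 1) / (N + 1)" "1 - m = 2 / (N + 1)" "1 + m = 2 * N / (N + 1)"
    using e1[of m] uv vm by (simp_all add: N_def)
  have at: "artanh u = ln U / 2" "artanh v = ln V / 2" "artanh m = ln N / 2"
    by (simp_all add: artanh_def U_def V_def N_def e_def)
  \<comment> \<open>The weights are ratios of the distances between \<open>u\<close>,
    \<open>m\<close> and \<open>v\<close>. As these are products in \<open>U\<close>,
    \<open>N\<close>, \<open>V\<close>, a common factor \<open>K\<close> can be split off
    below.\<close>
  have a: "a = (N - V) * (U + 1) / ((U - V) * (N + 1))"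
  proof -
    have "m - v = 2 * (N - V) / ((N + 1) * (V + 1))" "u - v = 2 * (U - V) / ((U + 1) * (V + 1))"
      unfolding xm(1) xv(1) xu(1) using ord by (simp_all add: divide_simps) (simp_all add: algebra_simps)
    moreover have "a = (m - v) / (u - v)" using mv uv by simp
    ultimately have "a = 2 * (N - V) / ((N + 1) * (V + 1)) / (2 * (U - V) / ((U + 1) * (V + 1)))"
      by (simp only:)
    also have "\<dots> = (N - V) * (U + 1) / ((U - V) * (N + 1))"
      using ord by (simp add: divide_simps) (simp add: algebra_simps)
    finally show ?thesis .
  qed
  have b: "b = (U - N) * (V + 1) / ((U - V) * (N + 1))"
  proof -
    have "u - m = 2 * (U - N) / ((N + 1) * (U + 1))" "u - v = 2 * (U - V) / ((U + 1) * (V + 1))"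
      unfolding xm(1) xv(1) xu(1) using ord by (simp_all add: divide_simps) (simp_all add: algebra_simps)
    moreover have "b = (u - m) / (u - v)" using um uv by simp
    ultimately have "b = 2 * (U - N) / ((N + 1) * (U + 1)) / (2 * (U - V) / ((U + 1) * (V + 1)))"
      by (simp only:)
    also have "\<dots> = (U - N) * (V + 1) / ((U - V) * (N + 1))"
      using ord by (simp add: divide_simps) (simp add: algebra_simps)
    finally show ?thesis .
  qed
  have dE: "((1 + x) * \<alpha> + (1 - x) * \<beta>) / 2 = (\<alpha> * E + \<beta>) / (E + 1)"
    if "1 - x = 2 / (E + 1)" "1 + x = 2 * E / (E + 1)" for x E
  proof -
    define k where "k = 1 / (E + 1)"
    have "1 - x = 2 * k" "1 + x = 2 * (E * k)" using that by (simp_all add: k_def)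
    then have "((1 + x) * \<alpha> + (1 - x) * \<beta>) / 2 = (\<alpha> * E + \<beta>) * k"
      by (simp only:) (simp add: algebra_simps)
    also have "\<dots> = (\<alpha> * E + \<beta>) / (E + 1)" by (simp add: k_def)
    finally show ?thesis .
  qed
  have du: "du = (\<alpha> * U + \<beta>) / (U + 1)" and dv: "dv = (\<alpha> * V + \<beta>) / (V + 1)"
    and dm: "dm = (\<alpha> * N + \<beta>) / (N + 1)"
    unfolding du_def dv_def dm_def using dE xu xv xm by blast+
  have sq: "1 - x\<^sup>2 = 4 * E / (E + 1)\<^sup>2"
    if "1 - x = 2 / (E + 1)" "1 + x = 2 * E / (E + 1)" for x E :: real
  proof -
    have "1 - x\<^sup>2 = (1 - x) * (1 + x)" by algebra
    then show ?thesis by (simp add: that power2_eq_square)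
  qed
  note sqs = sq[OF xu(2,3)] sq[OF xv(2,3)] sq[OF xm(2,3)]
  define k where "k = (ln U - ln N) / (U - N)"
  define l where "l = (ln N - ln V) / (N - V)"
  have kl: "ln U = ln N + k * (U - N)" "ln V = ln N - l * (N - V)"
    using ord by (simp_all add: k_def l_def)
  define K where "K = (N - V) * (U - N) / (N + 1)"
  have K: "K > 0" using ord by (simp add: K_def)
  \<comment> \<open>With the logarithms written relative to \<open>ln N\<close>, both summands of
    \<open>crit\<close> carry the factor \<open>K / (2 * (U - V))\<close>.\<close>
  have crit': "(\<alpha> * U + \<beta>) * k = (\<alpha> * V + \<beta>) * l"
  proof -
    have "a * du * (artanh u - artanh m) = (K / (2 * (U - V))) * ((\<alpha> * U + \<beta>) * k)"
      unfolding at kl a du K_def using ord by (simp add: divide_simps) 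
    moreover have "b * dv * (artanh v - artanh m) = - (K / (2 * (U - V))) * ((\<alpha> * V + \<beta>) * l)"
      unfolding at kl b dv K_def using ord by (simp add: divide_simps)
    ultimately have "(K / (2 * (U - V))) * ((\<alpha> * U + \<beta>) * k) = (K / (2 * (U - V))) * ((\<alpha> * V + \<beta>) * l)"
      using crit by simp
    then show ?thesis using K ord by simp
  qed
  have frac: "(p / n)\<^sup>2 \<le> 4 * E / n\<^sup>2 \<longleftrightarrow> p\<^sup>2 \<le> 4 * E" if "n > 0" for p n E :: real
    using that by (simp add: power_divide divide_le_cancel)
  have cU: "(\<alpha> * U + \<beta>)\<^sup>2 \<le> 4 * U" and cV: "(\<alpha> * V + \<beta>)\<^sup>2 \<le> 4 * V"
    using c ord unfolding du dv sqs by (simp_all add: frac)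
  note crit'' = crit'[unfolded k_def l_def]
  have key: "(\<alpha>\<^sup>2 + \<beta>\<^sup>2 / (U * V * N)) * (\<alpha> * V + \<beta>) < 2 * (\<alpha> + \<beta>) * k"
    unfolding k_def by (rule critical_curvature_inequality[OF ord pos crit'' cU cV])
  have "\<alpha> > 0" "\<beta> > 0" using critical_slopes_pos[OF ord pos crit''] by auto
  then have pV: "\<alpha> * V + \<beta> > 0" using ord by (simp add: add_pos_pos)
  have Q: "((\<alpha> * E + \<beta>) / (E + 1))\<^sup>2 / (4 * E / (E + 1)\<^sup>2) = (\<alpha>\<^sup>2 * E + 2 * \<alpha> * \<beta> + \<beta>\<^sup>2 / E) / 4"
    if "E > 0" for E
  proof -
    have "((\<alpha> * E + \<beta>) / (E + 1))\<^sup>2 / (4 * E / (E + 1)\<^sup>2) = (\<alpha> * E + \<beta>)\<^sup>2 / (4 * E)"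
      using that by (simp add: power_divide)
    also have "\<dots> = (\<alpha>\<^sup>2 * E + 2 * \<alpha> * \<beta> + \<beta>\<^sup>2 / E) / 4"
      using that by (simp add: field_simps power2_eq_square)
    finally show ?thesis .
  qed
  \<comment> \<open>\<open>s1\<close> and \<open>s2\<close> are the Jensen gaps of E and 1/E, viewed
    as functions of the coordinate whose mean is \<open>m\<close>. They multiply
    \<open>\<alpha>\<^sup>2\<close> and \<open>\<beta>\<^sup>2\<close>; the mixed term drops out
    since \<open>a + b = 1\<close>.\<close>
  have s1: "a * U + b * V - N = K"
    unfolding a b K_def using ord by (simp add: divide_simps) (simp add: algebra_simps)
  have s2: "a / U + b / V - 1 / N = K / (U * V * N)"
    unfolding a b K_def using ord by (simp add: divide_simps) (simp add: algebra_simps)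
  have "a * (du\<^sup>2 / (1 - u\<^sup>2)) + b * (dv\<^sup>2 / (1 - v\<^sup>2)) - dm\<^sup>2 / (1 - m\<^sup>2)
    = (\<alpha>\<^sup>2 * (a * U + b * V - N) + 2 * \<alpha> * \<beta> * (a + b - 1) + \<beta>\<^sup>2 * (a / U + b / V - 1 / N)) / 4"
    using ord unfolding du dv dm sqs by (simp only: Q) (simp add: algebra_simps add_divide_distrib)
  also have "\<dots> = K / 4 * (\<alpha>\<^sup>2 + \<beta>\<^sup>2 / (U * V * N))"
    unfolding s1 s2 ab(3) by (simp add: algebra_simps)
  also have "\<dots> < K / 4 * (2 * (\<alpha> + \<beta>) * k / (\<alpha> * V + \<beta>))"
    using key pV K by (intro mult_strict_left_mono) (simp_all add: pos_less_divide_eq)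
  \<comment> \<open>The parts with \<open>ln N\<close> cancel because
    \<open>m = a * u + b * v\<close>, the rest again has the factor \<open>K\<close>, and
    \<open>crit'\<close> eliminates \<open>l\<close>.\<close>
  also have "\<dots> = a * (u * artanh u) + b * (v * artanh v) - m * artanh m"
  proof -
    have "a * (u * artanh u) + b * (v * artanh v) - m * artanh m = K / (2 * (U - V)) * ((U - 1) * k - (V - 1) * l)"
    proof -
      have "a * u = (N - V) * (U - 1) / ((U - V) * (N + 1))" "b * v = (U - N) * (V - 1) / ((U - V) * (N + 1))"
        unfolding a b xu(1) xv(1) using ord by simp_all
      then have p: "a * u = K / (U - V) * ((U - 1) / (U - N))" "b * v = K / (U - V) * ((V - 1) / (N - V))"
        unfolding K_def using ord by (simp_all add: divide_simps mult.commute)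
      have "a * (u * artanh u) + b * (v * artanh v) - m * artanh m
          = (a * u * (k * (U - N)) - b * v * (l * (N - V))) / 2"
        unfolding at kl using m by (simp add: algebra_simps add_divide_distrib diff_divide_distrib)
      also have "\<dots> = (K / (U - V) * ((U - 1) * k) - K / (U - V) * ((V - 1) * l)) / 2"
        unfolding p using ord by simp
      also have "\<dots> = K / (2 * (U - V)) * ((U - 1) * k - (V - 1) * l)"
        by (simp add: right_diff_distrib diff_divide_distrib mult.commute)
      finally show ?thesis .
    qed
    also have "(U - 1) * k - (V - 1) * l = (U - V) * (\<alpha> + \<beta>) * k / (\<alpha> * V + \<beta>)"
    proof -
      have "((U - 1) * k - (V - 1) * l) * (\<alpha> * V + \<beta>) = (U - 1) * k * (\<alpha> * V + \<beta>) - (V - 1) * ((\<alpha> * V + \<beta>) * l)"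
        by algebra
      also have "\<dots> = (U - V) * (\<alpha> + \<beta>) * k" unfolding crit'[symmetric] by algebra
      finally show ?thesis using pV by (simp add: eq_divide_eq)
    qed
    also have "K / (2 * (U - V)) * ((U - V) * (\<alpha> + \<beta>) * k / (\<alpha> * V + \<beta>))
        = K / 4 * (2 * (\<alpha> + \<beta>) * k / (\<alpha> * V + \<beta>))"
      using ord pV by (simp add: divide_simps) (simp add: algebra_simps)
    finally show ?thesis by (rule sym)
  qed
  finally show ?thesis by (simp add: algebra_simps)
qed

section \<open>Entropy along a rotating axis\<close>

text \<open>The outcome entropy of a state whose Bloch vector has component \<open>u\<close> along
  the axis: the probabilities are \<open>(1 + u) / 2\<close> and \<open>(1 - u) / 2\<close>.\<close>

definition bloch_entropy :: "real \<Rightarrow> real" where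
  "bloch_entropy u = binary_entropy ((1 + u) / 2)"

lemma bloch_entropy_eq:
  "bloch_entropy u = - ((1 + u) / 2 * ln ((1 + u) / 2)) - (1 - u) / 2 * ln ((1 - u) / 2)"
proof -
  have "1 - (1 + u) / 2 = (1 - u) / 2" by (simp add: field_simps)
  then show ?thesis by (simp only: bloch_entropy_def binary_entropy_def minus_mult_left)
qed

lemma bloch_entropy_minus: "bloch_entropy (- u) = bloch_entropy u"
  by (simp add: bloch_entropy_eq)

lemma bloch_entropy_has_real_derivative:
  assumes "\<bar>u\<bar> < 1"
  shows "(bloch_entropy has_real_derivative - artanh u) (at u)"
proof -
  have eq: "bloch_entropy = (\<lambda>u. - ((1 + u) / 2 * ln ((1 + u) / 2)) - (1 - u) / 2 * ln ((1 - u) / 2))"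
    by (rule ext) (rule bloch_entropy_eq)
  have u: "1 + u > 0" "1 - u > 0" using assms by auto
  have "(bloch_entropy has_real_derivative
     - (1 / 2 * ln ((1 + u) / 2) + 1 / 2) - (- 1 / 2 * ln ((1 - u) / 2) - 1 / 2)) (at u)"
    unfolding eq
    by (rule derivative_eq_intros refl | use u in \<open>simp add: field_simps\<close>)+
  also have "- (1 / 2 * ln ((1 + u) / 2) + 1 / 2) - (- 1 / 2 * ln ((1 - u) / 2) - 1 / 2) = - artanh u"
  proof -
    have "ln ((1 + u) / 2) = ln (1 + u) - ln 2" "ln ((1 - u) / 2) = ln (1 - u) - ln 2"
      using u by (simp_all add: ln_div)
    moreover have "artanh u = (ln (1 + u) - ln (1 - u)) / 2"
      unfolding artanh_def using u by (simp add: ln_div)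
    ultimately show ?thesis by (simp add: field_simps)
  qed
  finally show ?thesis .
qed

lemma square_ln_square_has_derivative_0:
  "((\<lambda>z::real. z\<^sup>2 * ln (z\<^sup>2)) has_real_derivative 0) (at 0)"
proof -
  have "((\<lambda>z::real. z * ln (z\<^sup>2)) \<longlongrightarrow> 0) (at 0)"
    by real_asymp
  moreover have "\<forall>\<^sub>F z::real in at 0. z * ln (z\<^sup>2) = (z\<^sup>2 * ln (z\<^sup>2) - 0\<^sup>2 * ln (0\<^sup>2)) / (z - 0)"
    by (rule eventually_at_filter[THEN iffD2]) (simp add: power2_eq_square)
  ultimately show ?thesis
    unfolding has_field_derivative_iff by (rule Lim_transform_eventually)
qed

text \<open>The slope of \<open>bloch_entropy\<close> is unbounded near 1, but the half-angle
  formulas turn both probabilities into squares, and \<open>z\<^sup>2 * ln (z\<^sup>2)\<close> is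
  differentiable even at 0.\<close>

lemma bloch_entropy_cos_has_derivative_0:
  "((\<lambda>t. bloch_entropy (cos (t - \<theta>))) has_real_derivative 0) (at \<theta>)"
proof -
  define f where "f = (\<lambda>z::real. z\<^sup>2 * ln (z\<^sup>2))"
  have c: "(1 + cos t) / 2 = (cos (t / 2))\<^sup>2" "1 - (1 + cos t) / 2 = (sin (t / 2))\<^sup>2" for t :: real
    using cos_double_cos[of "t / 2"] sin_cos_squared_add[of "t / 2"] by (simp_all add: field_simps)
  have eq: "bloch_entropy (cos (t - \<theta>)) = - f (cos ((t - \<theta>) / 2)) - f (sin ((t - \<theta>) / 2))" for t
    unfolding bloch_entropy_def binary_entropy_def c(2) by (simp add: c(1) f_def)
  have f1: "(f has_real_derivative 2) (at (cos ((\<theta> - \<theta>) / 2)))"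
    unfolding f_def by (rule derivative_eq_intros refl | simp)+
  have f0: "(f has_real_derivative 0) (at (sin ((\<theta> - \<theta>) / 2)))"
    using square_ln_square_has_derivative_0 by (simp add: f_def)
  have dc: "((\<lambda>t. cos ((t - \<theta>) / 2)) has_real_derivative 0) (at \<theta>)"
    by (rule derivative_eq_intros refl | simp)+
  have ds: "((\<lambda>t. sin ((t - \<theta>) / 2)) has_real_derivative 1 / 2) (at \<theta>)"
    by (rule derivative_eq_intros refl | simp)+
  show ?thesis
    unfolding eq using DERIV_diff[OF DERIV_minus[OF DERIV_chain2[OF f1 dc]] DERIV_chain2[OF f0 ds]]
    by simp
qed

text \<open>At a pure state aligned with the measurement axis \<open>artanh\<close> takes the junk value
  \<open>artanh (\<plusminus>1) = 0\<close>; there the velocity vanishes as well, so the formula stays correct.\<close>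

lemma bloch_entropy_rotation_has_real_derivative:
  fixes x h \<theta> :: real
  assumes "x\<^sup>2 + h\<^sup>2 \<le> 1"
  shows "((\<lambda>t. bloch_entropy (x * cos t + h * sin t)) has_real_derivative
    - (artanh (x * cos \<theta> + h * sin \<theta>) * (h * cos \<theta> - x * sin \<theta>))) (at \<theta>)"
proof -
  define X where "X = x * cos \<theta> + h * sin \<theta>"
  define Y where "Y = h * cos \<theta> - x * sin \<theta>"
  have XY: "X\<^sup>2 + Y\<^sup>2 = x\<^sup>2 + h\<^sup>2"
    unfolding X_def Y_def using sin_cos_squared_add[of \<theta>] by algebra
  show ?thesis
  proof (cases "\<bar>X\<bar> < 1")
    case True
    have "((\<lambda>t. x * cos t + h * sin t) has_real_derivative Y) (at \<theta>)"
      unfolding Y_def by (rule derivative_eq_intros refl | simp)+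
    from DERIV_chain2[OF bloch_entropy_has_real_derivative[OF True, unfolded X_def] this]
    show ?thesis unfolding X_def Y_def by simp
  next
    case False
    then have "X\<^sup>2 \<ge> 1" by (metis abs_square_less_1 not_less)
    with XY assms have X: "X\<^sup>2 = 1" and "Y\<^sup>2 = 0"
      by (smt (verit) zero_le_power2)+
    then have Y: "Y = 0" by simp
    \<comment> \<open>Angle addition around \<theta>. As \<open>Y\<close> vanishes and
      \<open>X\<close> is 1 or -1, evenness of the entropy leaves only the cosine.\<close>
    have "x * cos t + h * sin t = X * cos (t - \<theta>) + Y * sin (t - \<theta>)" for t
      unfolding X_def Y_def cos_diff sin_diff using sin_cos_squared_add[of \<theta>] by algebra
    moreover have "X = 1 \<or> X = -1" using X by (simp add: power2_eq_1_iff)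
    ultimately have "(\<lambda>t. bloch_entropy (x * cos t + h * sin t)) = (\<lambda>t. bloch_entropy (cos (t - \<theta>)))"
      using Y bloch_entropy_minus by auto
    then show ?thesis
      using bloch_entropy_cos_has_derivative_0 Y by (simp add: Y_def)
  qed
qed

text \<open>Rolle provides a critical point \<open>m\<close>, and every critical point is a strict
  local maximum. A wrong sign of \<open>f'\<close> on one side of \<open>m\<close> would create a
  minimum that is impossible between such maxima. Since \<open>f'\<close> is not assumed continuous,
  the argument works with minimizers of \<open>f\<close>.\<close>

lemma unimodal_of_negative_second_derivative:
  fixes f f' :: "real \<Rightarrow> real"
  assumes AB: "A < B" and ends: "f A = f B"
    and der: "\<And>x. (f has_real_derivative f' x) (at x)"
    and crit: "\<And>x. A < x \<Longrightarrow> x < B \<Longrightarrow> f' x = 0 \<Longrightarrow> \<exists>D<0. (f' has_real_derivative D) (at x)"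
  obtains m where "A < m" "m < B" "f' m = 0"
    "\<And>x. A < x \<Longrightarrow> x < m \<Longrightarrow> 0 < f' x" "\<And>x. m < x \<Longrightarrow> x < B \<Longrightarrow> f' x < 0"
proof -
  have cont: "continuous_on S f" for S
    using der by (meson DERIV_isCont continuous_at_imp_continuous_on)
  have right: "\<exists>d>0. \<forall>y. x < y \<longrightarrow> y < x + d \<longrightarrow> f y < f x" if x: "A < x" "x < B" "f' x = 0" for x
  proof -
    obtain D where "D < 0" "(f' has_real_derivative D) (at x)" using crit[OF x] by blast
    from DERIV_neg_dec_right[OF this(2,1)] x(3) obtain d where d: "d > 0"
      "\<And>h. 0 < h \<Longrightarrow> h < d \<Longrightarrow> f' (x + h) < 0" by auto
    have "f y < f x" if y: "x < y" "y < x + d" for y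
    proof (rule DERIV_neg_imp_decreasing_open[OF y(1) _ cont])
      show "\<exists>D. (f has_real_derivative D) (at z) \<and> D < 0" if "x < z" "z < y" for z
        using der d(2)[of "z - x"] y that by (intro exI[of _ "f' z"]) auto
    qed
    with d(1) show ?thesis by blast
  qed
  have left: "\<exists>d>0. \<forall>y. x - d < y \<longrightarrow> y < x \<longrightarrow> f y < f x" if x: "A < x" "x < B" "f' x = 0" for x
  proof -
    obtain D where "D < 0" "(f' has_real_derivative D) (at x)" using crit[OF x] by blast
    from DERIV_neg_dec_left[OF this(2,1)] x(3) obtain d where d: "d > 0"
      "\<And>h. 0 < h \<Longrightarrow> h < d \<Longrightarrow> 0 < f' (x - h)" by auto
    have "f y < f x" if y: "x - d < y" "y < x" for y
    proof (rule DERIV_pos_imp_increasing_open[OF y(2) _ cont])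
      show "\<exists>D. (f has_real_derivative D) (at z) \<and> D > 0" if "y < z" "z < x" for z
        using der d(2)[of "x - z"] y that by (intro exI[of _ "f' z"]) auto
    qed
    with d(1) show ?thesis by blast
  qed
  obtain m where m: "A < m" "m < B" "(f has_real_derivative 0) (at m)"
    using Rolle[OF AB ends cont] der by (metis real_differentiable_def)
  then have m0: "f' m = 0" using der DERIV_unique by blast
  have min_at: "\<exists>z\<in>{p..q}. \<forall>y\<in>{p..q}. f z \<le> f y" if "p \<le> q" for p q
    using continuous_attains_inf[of "{p..q}" f] cont that by auto
  have pos: "0 < f' x" if x: "A < x" "x < m" for x
  proof (rule ccontr)
    assume neg: "\<not> 0 < f' x"
    \<comment> \<open>The minimizer is neither \<open>m\<close> nor any other critical point, both
      being strict local maxima. Being left of \<open>m\<close> it has \<open>f' z > 0\<close>,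
      hence differs from \<open>x\<close>; but then \<open>f\<close> is smaller just to the left of
      \<open>z\<close>.\<close>
    obtain z where z: "x \<le> z" "z \<le> m" and zmin: "\<And>y. x \<le> y \<Longrightarrow> y \<le> m \<Longrightarrow> f z \<le> f y"
      using min_at[of x m] x by auto
    have "z \<noteq> m"
    proof
      assume "z = m"
      obtain d where d: "d > 0" "\<And>y. m - d < y \<Longrightarrow> y < m \<Longrightarrow> f y < f m" using left[OF m(1,2) m0] by blast
      obtain y where "max (m - d) x < y" "y < m" using dense[of "max (m - d) x" m] d(1) x by auto
      with d(2)[of y] zmin[of y] \<open>z = m\<close> show False by simp
    qed
    with z have zm: "z < m" by simp
    have nz: "f' z \<noteq> 0"
    proof
      assume "f' z = 0"
      then obtain d where d: "d > 0" "\<And>y. z < y \<Longrightarrow> y < z + d \<Longrightarrow> f y < f z" using right[of z] z x m by force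
      obtain y where "z < y" "y < min (z + d) m" using dense[of z "min (z + d) m"] d(1) zm by auto
      with d(2)[of y] zmin[of y] z show False by simp
    qed
    have "f' z \<ge> 0"
    proof (rule ccontr)
      assume "\<not> f' z \<ge> 0"
      then obtain d where d: "d > 0" "\<And>h. 0 < h \<Longrightarrow> h < d \<Longrightarrow> f (z + h) < f z"
        using DERIV_neg_dec_right[OF der, of z] by auto
      obtain h where "0 < h" "h < min d (m - z)" using dense[of 0 "min d (m - z)"] d(1) zm by auto
      with d(2)[of h] zmin[of "z + h"] z show False by simp
    qed
    with nz have "f' z > 0" by simp
    with neg have "z \<noteq> x" by auto
    with z have "x < z" by simp
    obtain d where d: "d > 0" "\<And>h. 0 < h \<Longrightarrow> h < d \<Longrightarrow> f (z - h) < f z"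
      using DERIV_pos_inc_left[OF der \<open>f' z > 0\<close>] by auto
    obtain h where "0 < h" "h < min d (z - x)" using dense[of 0 "min d (z - x)"] d(1) \<open>x < z\<close> by auto
    with d(2)[of h] zmin[of "z - h"] z show False by simp
  qed
  have neg: "f' x < 0" if x: "m < x" "x < B" for x
  proof (rule ccontr)
    assume pos: "\<not> f' x < 0"
    obtain z where z: "m \<le> z" "z \<le> x" and zmin: "\<And>y. m \<le> y \<Longrightarrow> y \<le> x \<Longrightarrow> f z \<le> f y"
      using min_at[of m x] x by auto
    have "z \<noteq> m"
    proof
      assume "z = m"
      obtain d where d: "d > 0" "\<And>y. m < y \<Longrightarrow> y < m + d \<Longrightarrow> f y < f m" using right[OF m(1,2) m0] by blast
      obtain y where "m < y" "y < min (m + d) x" using dense[of m "min (m + d) x"] d(1) x by auto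
      with d(2)[of y] zmin[of y] \<open>z = m\<close> show False by simp
    qed
    with z have zm: "m < z" by simp
    have nz: "f' z \<noteq> 0"
    proof
      assume "f' z = 0"
      then obtain d where d: "d > 0" "\<And>y. z - d < y \<Longrightarrow> y < z \<Longrightarrow> f y < f z" using left[of z] z zm x m by force
      obtain y where "max (z - d) m < y" "y < z" using dense[of "max (z - d) m" z] d(1) zm by auto
      with d(2)[of y] zmin[of y] z show False by simp
    qed
    have "f' z \<le> 0"
    proof (rule ccontr)
      assume "\<not> f' z \<le> 0"
      then obtain d where d: "d > 0" "\<And>h. 0 < h \<Longrightarrow> h < d \<Longrightarrow> f (z - h) < f z"
        using DERIV_pos_inc_left[OF der, of z] by auto
      obtain h where "0 < h" "h < min d (z - m)" using dense[of 0 "min d (z - m)"] d(1) zm by auto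
      with d(2)[of h] zmin[of "z - h"] z show False by simp
    qed
    with nz have "f' z < 0" by simp
    with pos have "z \<noteq> x" by auto
    with z have "z < x" by simp
    obtain d where d: "d > 0" "\<And>h. 0 < h \<Longrightarrow> h < d \<Longrightarrow> f (z + h) < f z"
      using DERIV_neg_dec_right[OF der \<open>f' z < 0\<close>] by auto
    obtain h where "0 < h" "h < min d (x - z)" using dense[of 0 "min d (x - z)"] d(1) \<open>z < x\<close> by auto
    with d(2)[of h] zmin[of "z + h"] z show False by simp
  qed
  from m(1,2) m0 pos neg show thesis by (rule that)
qed

section \<open>Unimodality in the measurement angle\<close>

text \<open>In the Bloch plane \<open>x\<close> and \<open>y\<close> are the coordinates of the two
  states along their difference, \<open>h\<close> is the distance of their line from the origin, and
  \<theta> is the angle of the measurement axis from the direction of the difference.\<close>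

definition angle_information :: "real \<Rightarrow> real \<Rightarrow> real \<Rightarrow> real \<Rightarrow> real \<Rightarrow> real" where
  "angle_information a x y h \<theta> =
     bloch_entropy ((a * x + (1 - a) * y) * cos \<theta> + h * sin \<theta>)
     - a * bloch_entropy (x * cos \<theta> + h * sin \<theta>) - (1 - a) * bloch_entropy (y * cos \<theta> + h * sin \<theta>)"

text \<open>Minus the derivative of the outcome entropy of one state: the velocity of its component
  along the axis times \<open>artanh\<close> of that component.\<close>

definition rotation_artanh :: "real \<Rightarrow> real \<Rightarrow> real \<Rightarrow> real" where
  "rotation_artanh x h \<theta> = (h * cos \<theta> - x * sin \<theta>) * artanh (x * cos \<theta> + h * sin \<theta>)"

definition angle_information_deriv :: "real \<Rightarrow> real \<Rightarrow> real \<Rightarrow> real \<Rightarrow> real \<Rightarrow> real" where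
  "angle_information_deriv a x y h \<theta> =
     a * rotation_artanh x h \<theta> + (1 - a) * rotation_artanh y h \<theta>
     - rotation_artanh (a * x + (1 - a) * y) h \<theta>"

section \<open>First and second derivatives of the information in the angle\<close>

lemma mixture_norm_le:
  fixes x y h a :: real
  assumes "x\<^sup>2 + h\<^sup>2 \<le> 1" "y\<^sup>2 + h\<^sup>2 \<le> 1" "0 \<le> a" "a \<le> 1"
  shows "(a * x + (1 - a) * y)\<^sup>2 + h\<^sup>2 \<le> 1"
proof -
  have "(a * x + (1 - a) * y)\<^sup>2 + h\<^sup>2
      = a * (x\<^sup>2 + h\<^sup>2) + (1 - a) * (y\<^sup>2 + h\<^sup>2) - a * (1 - a) * (x - y)\<^sup>2"
    by algebra
  also have "\<dots> \<le> a * 1 + (1 - a) * 1 - 0"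
    using assms by (intro diff_mono add_mono mult_left_mono) auto
  finally show ?thesis by simp
qed

lemma angle_information_has_real_derivative:
  assumes "x\<^sup>2 + h\<^sup>2 \<le> 1" "y\<^sup>2 + h\<^sup>2 \<le> 1" "0 \<le> a" "a \<le> 1"
  shows "(angle_information a x y h has_real_derivative angle_information_deriv a x y h \<theta>) (at \<theta>)"
proof -
  note D = bloch_entropy_rotation_has_real_derivative
  have eq: "angle_information_deriv a x y h \<theta> =
    - (artanh ((a * x + (1 - a) * y) * cos \<theta> + h * sin \<theta>) * (h * cos \<theta> - (a * x + (1 - a) * y) * sin \<theta>))
    - a * - (artanh (x * cos \<theta> + h * sin \<theta>) * (h * cos \<theta> - x * sin \<theta>))
    - (1 - a) * - (artanh (y * cos \<theta> + h * sin \<theta>) * (h * cos \<theta> - y * sin \<theta>))"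
    by (simp add: angle_information_deriv_def rotation_artanh_def mult.commute)
  show ?thesis
    unfolding eq angle_information_def[abs_def]
    by (intro DERIV_diff DERIV_cmult D assms mixture_norm_le)
qed

lemma rotation_artanh_has_real_derivative:
  assumes "\<bar>x * cos \<theta> + h * sin \<theta>\<bar> < 1"
  shows "(rotation_artanh x h has_real_derivative
    (h * cos \<theta> - x * sin \<theta>)\<^sup>2 / (1 - (x * cos \<theta> + h * sin \<theta>)\<^sup>2)
    - (x * cos \<theta> + h * sin \<theta>) * artanh (x * cos \<theta> + h * sin \<theta>)) (at \<theta>)"
proof -
  have d: "((\<lambda>t. x * cos t + h * sin t) has_real_derivative h * cos \<theta> - x * sin \<theta>) (at \<theta>)"
    by (rule derivative_eq_intros refl | simp)+
  have e: "((\<lambda>t. h * cos t - x * sin t) has_real_derivative - (x * cos \<theta> + h * sin \<theta>)) (at \<theta>)"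
    by (rule derivative_eq_intros refl | simp)+
  have A: "(artanh has_real_derivative 1 / (1 - (x * cos \<theta> + h * sin \<theta>)\<^sup>2)) (at (x * cos \<theta> + h * sin \<theta>))"
    using assms by (rule artanh_real_has_field_derivative)
  have eq: "(h * cos \<theta> - x * sin \<theta>)\<^sup>2 / (1 - (x * cos \<theta> + h * sin \<theta>)\<^sup>2)
    - (x * cos \<theta> + h * sin \<theta>) * artanh (x * cos \<theta> + h * sin \<theta>)
    = - (x * cos \<theta> + h * sin \<theta>) * artanh (x * cos \<theta> + h * sin \<theta>)
      + 1 / (1 - (x * cos \<theta> + h * sin \<theta>)\<^sup>2) * (h * cos \<theta> - x * sin \<theta>) * (h * cos \<theta> - x * sin \<theta>)"
    by (simp add: power2_eq_square algebra_simps)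
  show ?thesis
    unfolding rotation_artanh_def[abs_def] eq by (rule DERIV_mult[OF e DERIV_chain2[OF A d]])
qed

lemma artanh_less:
  fixes x y :: real
  assumes "-1 < x" "x < y" "y < 1"
  shows "artanh x < artanh y"
proof -
  have "(1 + x) / (1 - x) < (1 + y) / (1 - y)" using assms by (simp add: field_simps)
  with assms show ?thesis by (simp add: artanh_def)
qed

text \<open>At a critical angle neither \<open>u = 1\<close> nor \<open>v = -1\<close> can occur, so
  the second derivative exists there, and its sign is given by
  \<open>artanh_curvature_at_critical_point\<close>.\<close>

lemma angle_information_second_derivative_neg:
  fixes x y h a \<theta> :: real
  assumes x: "x\<^sup>2 + h\<^sup>2 \<le> 1" and y: "y\<^sup>2 + h\<^sup>2 \<le> 1" and yx: "y < x" and h: "0 < h"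
    and a: "0 < a" "a < 1" and \<theta>: "- pi / 2 < \<theta>" "\<theta> < pi / 2"
    and crit: "angle_information_deriv a x y h \<theta> = 0"
  shows "\<exists>D<0. (angle_information_deriv a x y h has_real_derivative D) (at \<theta>)"
proof -
  define c where "c = cos \<theta>"
  define s where "s = sin \<theta>"
  have cs: "c\<^sup>2 + s\<^sup>2 = 1" by (simp add: c_def s_def)
  have c: "c > 0" using \<theta> by (simp add: c_def cos_gt_zero_pi)
  define z where "z = a * x + (1 - a) * y"
  define u v m du dv dm where defs: "u = x * c + h * s" "v = y * c + h * s" "m = z * c + h * s"
    "du = h * c - x * s" "dv = h * c - y * s" "dm = h * c - z * s"
  have vm: "v < u" using yx c by (simp add: defs)
  have meq: "m = a * u + (1 - a) * v" "dm = a * du + (1 - a) * dv"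
    unfolding defs z_def by algebra+
  have "m - v = a * (u - v)" "u - m = (1 - a) * (u - v)" unfolding meq by (simp_all add: algebra_simps)
  then have "m - v > 0" "u - m > 0" using a vm by simp_all
  then have m: "v < m" "m < u" by simp_all
  have "u\<^sup>2 + du\<^sup>2 = x\<^sup>2 + h\<^sup>2" "v\<^sup>2 + dv\<^sup>2 = y\<^sup>2 + h\<^sup>2" unfolding defs using cs by algebra+
  with x y have bu: "u\<^sup>2 + du\<^sup>2 \<le> 1" and bv: "v\<^sup>2 + dv\<^sup>2 \<le> 1" by simp_all
  \<comment> \<open>A determinant invariant under rotation, hence equal to its value at angle 0. If
    one velocity vanishes at an extreme component, it fixes the sign of the other.\<close>
  have "u * dv - du * v = h * (x - y)" unfolding defs using cs by algebra
  with h yx have W: "u * dv - du * v > 0" by simp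
  have le: "\<bar>u\<bar> \<le> 1" "\<bar>v\<bar> \<le> 1"
  proof -
    have "u\<^sup>2 \<le> 1" "v\<^sup>2 \<le> 1" using bu bv zero_le_power2[of du] zero_le_power2[of dv] by linarith+
    then show "\<bar>u\<bar> \<le> 1" "\<bar>v\<bar> \<le> 1" by (simp_all only: abs_square_le_1)
  qed
  have deriv: "angle_information_deriv a x y h \<theta> =
      a * (du * (artanh u - artanh m)) + (1 - a) * (dv * (artanh v - artanh m))"
  proof -
    have "angle_information_deriv a x y h \<theta> = a * (du * artanh u) + (1 - a) * (dv * artanh v) - dm * artanh m"
      by (simp add: angle_information_deriv_def rotation_artanh_def defs z_def c_def s_def)
    then show ?thesis unfolding meq(2) by (simp add: algebra_simps)
  qed
  \<comment> \<open>For \<open>u = 1\<close> the velocity \<open>du\<close> is 0, so the first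
    derivative reduces to the term with \<open>dv\<close>, which is strictly negative. The case
    \<open>v = -1\<close> is symmetric.\<close>
  have u1: "u < 1"
  proof (rule ccontr)
    assume "\<not> u < 1"
    with le have u: "u = 1" by simp
    with bu have du: "du = 0" by simp
    with W u have dv: "dv > 0" by simp
    have "v \<noteq> -1" using bv dv by auto
    with le m u have "artanh v < artanh m" by (intro artanh_less) auto
    with dv a have "(1 - a) * (dv * (artanh v - artanh m)) < 0" by (simp add: mult_pos_neg)
    moreover have "angle_information_deriv a x y h \<theta> = (1 - a) * (dv * (artanh v - artanh m))"
      using deriv du by simp
    ultimately show False using crit by linarith
  qed
  have v1: "-1 < v"
  proof (rule ccontr)
    assume "\<not> -1 < v"
    with le have v: "v = -1" by simp
    with bv have dv: "dv = 0" by simp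
    with W v have du: "du > 0" by simp
    have "artanh m < artanh u" using v m u1 by (intro artanh_less) auto
    with du a have "a * (du * (artanh u - artanh m)) > 0" by simp
    moreover have "angle_information_deriv a x y h \<theta> = a * (du * (artanh u - artanh m))"
      using deriv dv by simp
    ultimately show False using crit by linarith
  qed
  \<comment> \<open>The velocity is \<open>(h - X * s) / c\<close> as a function of the component
    \<open>X\<close>; these are its values at 1 and at -1.\<close>
  define \<alpha> \<beta> where ab: "\<alpha> = (h - s) / c" "\<beta> = (h + s) / c"
  have lin: "((1 + w * c + h * s) * \<alpha> + (1 - (w * c + h * s)) * \<beta>) / 2 = h * c - w * s" for w
  proof -
    have "((1 + w * c + h * s) * \<alpha> + (1 - (w * c + h * s)) * \<beta>) / 2 = (h - (w * c + h * s) * s) / c"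
      using c by (simp add: ab field_simps)
    also have "h - (w * c + h * s) * s = (h * c - w * s) * c" using cs by algebra
    finally show ?thesis using c by simp
  qed
  have du: "((1 + u) * \<alpha> + (1 - u) * \<beta>) / 2 = du" and dv: "((1 + v) * \<alpha> + (1 - v) * \<beta>) / 2 = dv"
    and dm: "((1 + m) * \<alpha> + (1 - m) * \<beta>) / 2 = dm"
    using lin[of x] lin[of y] lin[of z] by (simp_all add: defs add.assoc)
  have "\<alpha> + \<beta> = 2 * h / c" by (simp add: ab add_divide_distrib[symmetric])
  then have pos: "\<alpha> + \<beta> > 0" using h c by simp
  have "a * (du\<^sup>2 / (1 - u\<^sup>2) - u * artanh u) + (1 - a) * (dv\<^sup>2 / (1 - v\<^sup>2) - v * artanh v)
      < dm\<^sup>2 / (1 - m\<^sup>2) - m * artanh m"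
    by (rule artanh_curvature_at_critical_point[of v u a "1 - a" m \<alpha> \<beta>, unfolded du dv dm])
      (use v1 u1 vm a meq pos bu bv crit[unfolded deriv] in \<open>simp_all add: mult.assoc\<close>)
  moreover have "(angle_information_deriv a x y h has_real_derivative
      a * (du\<^sup>2 / (1 - u\<^sup>2) - u * artanh u) + (1 - a) * (dv\<^sup>2 / (1 - v\<^sup>2) - v * artanh v)
      - (dm\<^sup>2 / (1 - m\<^sup>2) - m * artanh m)) (at \<theta>)"
    unfolding angle_information_deriv_def[abs_def] defs c_def s_def z_def
    by (intro DERIV_diff DERIV_add DERIV_cmult rotation_artanh_has_real_derivative)
      (use v1 u1 m in \<open>auto simp: defs c_def s_def z_def\<close>)
  ultimately show ?thesis by (meson diff_less_0_iff_less)
qed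

lemma angle_information_unimodal:
  fixes x y h a :: real
  assumes x: "x\<^sup>2 + h\<^sup>2 \<le> 1" and y: "y\<^sup>2 + h\<^sup>2 \<le> 1" and yx: "y < x" and h: "0 < h"
    and a: "0 < a" "a < 1"
  obtains m where "- pi / 2 < m" "m < pi / 2" "angle_information_deriv a x y h m = 0"
    "\<And>\<theta>. - pi / 2 < \<theta> \<Longrightarrow> \<theta> < m \<Longrightarrow> 0 < angle_information_deriv a x y h \<theta>"
    "\<And>\<theta>. m < \<theta> \<Longrightarrow> \<theta> < pi / 2 \<Longrightarrow> angle_information_deriv a x y h \<theta> < 0"
proof (rule unimodal_of_negative_second_derivative)
  show "- pi / 2 < pi / 2" by simp
  \<comment> \<open>The two angles orient the same axis oppositely, and the entropy is even.\<close>
  show "angle_information a x y h (- pi / 2) = angle_information a x y h (pi / 2)"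
    by (simp add: angle_information_def bloch_entropy_minus)
  show "(angle_information a x y h has_real_derivative angle_information_deriv a x y h \<theta>) (at \<theta>)" for \<theta>
    using x y a by (intro angle_information_has_real_derivative) auto
qed (use angle_information_second_derivative_neg[OF assms] that in blast)+

section \<open>Bloch vectors\<close>

lemma matrix_mult_scaleR:
  fixes A :: "complex^'n^'m" and B :: "complex^'k^'n"
  shows "(c *\<^sub>R A) ** B = c *\<^sub>R (A ** B)" "A ** (c *\<^sub>R B) = c *\<^sub>R (A ** B)"
  by (simp_all add: matrix_matrix_mult_def vec_eq_iff scaleR_sum_right)

lemma matrix_add_rdistrib: "(A + B) ** C = A ** C + B ** C" for A B C :: "complex^'n^'n"
  by (simp add: matrix_matrix_mult_def vec_eq_iff distrib_right sum.distrib)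

lemma trace_scaleR: "trace (c *\<^sub>R A) = c *\<^sub>R trace A" for A :: "complex^'n^'n"
  by (simp add: trace_def scaleR_sum_right)

text \<open>The combination of the three Pauli matrices with coefficient vector
  \<open>r\<close>.\<close>

definition pauli :: "real^3 \<Rightarrow> complex^2^2" where
  "pauli r = vector [vector [of_real (r $ 3), Complex (r $ 1) (- (r $ 2))],
                     vector [Complex (r $ 1) (r $ 2), - of_real (r $ 3)]]"

text \<open>Used in two roles: the qubit state with Bloch vector \<open>r\<close>, and, for a unit
  vector, the rank-one projection belonging to that axis.\<close>

definition bloch :: "real^3 \<Rightarrow> complex^2^2" where
  "bloch r = (1 / 2) *\<^sub>R (mat 1 + pauli r)"

lemma pauli_nth:
  "pauli r $ 1 $ 1 = of_real (r $ 3)" "pauli r $ 1 $ 2 = Complex (r $ 1) (- (r $ 2))"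
  "pauli r $ 2 $ 1 = Complex (r $ 1) (r $ 2)" "pauli r $ 2 $ 2 = - of_real (r $ 3)"
  by (simp_all add: pauli_def)

lemma pauli_linear:
  "pauli (r + s) = pauli r + pauli s" "pauli (r - s) = pauli r - pauli s" "pauli (- r) = - pauli r"
  "pauli (c *\<^sub>R r) = c *\<^sub>R pauli r"
  by (simp_all add: vec_eq_iff forall_2 pauli_nth complex_eq_iff)

lemma self_adjoint_combination: "self_adjoint (c *\<^sub>R mat 1 + k *\<^sub>R pauli r)"
  by (simp add: self_adjoint_def adjoint_matrix_def vec_eq_iff forall_2 pauli_nth complex_eq_iff mat_def)

lemma pauli_square: "pauli r ** pauli r = (r \<bullet> r) *\<^sub>R mat 1"
  by (simp add: vec_eq_iff forall_2 matrix_matrix_mult_def sum_2 pauli_nth complex_eq_iff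
      inner_vec_def sum_3 mat_def algebra_simps)

lemma trace_pauli_pauli: "Re (trace (pauli r ** pauli s)) = 2 * (r \<bullet> s)"
  by (simp add: trace_def matrix_matrix_mult_def sum_2 pauli_nth inner_vec_def sum_3 algebra_simps)

lemma trace_bloch_pauli: "Re (trace (bloch r ** pauli s)) = r \<bullet> s"
  by (simp add: bloch_def trace_def matrix_matrix_mult_def sum_2 pauli_nth inner_vec_def sum_3 mat_def
      algebra_simps)

lemma born_bloch: "born (bloch r) (bloch n) = (1 + r \<bullet> n) / 2"
  by (simp add: born_def bloch_def trace_def matrix_matrix_mult_def sum_2 pauli_nth inner_vec_def sum_3
      mat_def field_simps)

lemma bloch_projection:
  assumes "norm n = 1"
  shows "self_adjoint (bloch n)" "bloch n ** bloch n = bloch n"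
proof -
  show "self_adjoint (bloch n)"
    using self_adjoint_combination[of "1 / 2" "1 / 2" n] by (simp add: bloch_def scaleR_right_distrib)
  have "n \<bullet> n = 1" using assms by (simp add: dot_square_norm)
  then have "pauli n ** pauli n = mat 1" by (simp add: pauli_square)
  then have "(mat 1 + pauli n) ** (mat 1 + pauli n) = 2 *\<^sub>R (mat 1 + pauli n)"
    by (simp add: matrix_add_ldistrib matrix_add_rdistrib scaleR_2 algebra_simps)
  then show "bloch n ** bloch n = bloch n"
    by (simp add: bloch_def matrix_mult_scaleR)
qed

text \<open>The operator equals \<open>c - k\<close> times the identity plus \<open>2 * k\<close>
  times the projection \<open>bloch n\<close>, whose range is therefore the eigenspace for
  \<open>c + k\<close>. Either sign of \<open>k\<close> is allowed; a negative one occurs for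
  \<open>H\<close>.\<close>

lemma spectral_projection_bloch:
  assumes n: "norm n = 1" and k: "k \<noteq> 0"
  shows "spectral_projection (c *\<^sub>R mat 1 + k *\<^sub>R pauli n) (bloch n)"
proof -
  define A where "A = c *\<^sub>R mat 1 + k *\<^sub>R pauli n"
  define e where "e = complex_of_real (c + k)"
  note P = bloch_projection[OF n]
  have A: "A *v v = of_real (c - k) *s v + of_real (2 * k) *s (bloch n *v v)" for v
    by (simp add: A_def bloch_def vec_eq_iff forall_2 matrix_vector_mult_def sum_2 mat_def pauli_nth)
      (simp add: complex_eq_iff algebra_simps)
  have eig: "A *v (bloch n *v v) = e *s (bloch n *v v)" for v
  proof -
    have "bloch n *v (bloch n *v v) = bloch n *v v" by (simp add: matrix_vector_mul_assoc P)
    then show ?thesis by (simp only: A) (simp add: e_def vec_eq_iff algebra_simps)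
  qed
  have "range ((*v) (bloch n)) = eigenspace A e"
  proof
    show "range ((*v) (bloch n)) \<subseteq> eigenspace A e"
      using eig by (auto simp: eigenspace_def)
    show "eigenspace A e \<subseteq> range ((*v) (bloch n))"
    proof
      fix v assume "v \<in> eigenspace A e"
      then have "of_real (c - k) *s v + of_real (2 * k) *s (bloch n *v v) = e *s v"
        by (simp add: eigenspace_def A)
      then have "of_real (2 * k) * (bloch n *v v) $ i = of_real (2 * k) * v $ i" for i
        by (simp add: vec_eq_iff e_def algebra_simps) (metis add_right_cancel)
      with k have "bloch n *v v = v" by (simp add: vec_eq_iff)
      then show "v \<in> range ((*v) (bloch n))" by (metis rangeI)
    qed
  qed
  moreover have "e \<in> eigenvalues A"
  proof -
    have "trace (bloch n) = 1"
      by (simp add: bloch_def trace_def sum_2 pauli_nth mat_def complex_eq_iff flip: add_divide_distrib)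
    then have "bloch n \<noteq> 0" by (auto simp: trace_def)
    then obtain v where "bloch n *v v \<noteq> 0"
      by (metis matrix_eq matrix_vector_mult_0)
    with eig show ?thesis by (auto simp: eigenvalues_def eigenspace_def)
  qed
  ultimately show ?thesis using P unfolding spectral_projection_def A_def by blast
qed

lemma density_operator_bloch:
  assumes "density_operator \<rho>"
  obtains r where "\<rho> = bloch r" "norm r \<le> 1"
proof -
  have sa: "\<rho> $ i $ j = cnj (\<rho> $ j $ i)" for i j
    using assms by (metis (no_types, lifting) adjoint_matrix_def density_operator_def positive_semidefinite_def
        self_adjoint_def vec_lambda_beta)
  have tr: "\<rho> $ 1 $ 1 + \<rho> $ 2 $ 2 = 1"
    using assms by (simp add: density_operator_def trace_def sum_2)
  define r :: "real^3" where
    "r = vector [2 * Re (\<rho> $ 2 $ 1), 2 * Im (\<rho> $ 2 $ 1), 2 * Re (\<rho> $ 1 $ 1) - 1]"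
  have im: "Im (\<rho> $ 1 $ 1) = 0" "Im (\<rho> $ 2 $ 2) = 0" and off: "\<rho> $ 1 $ 2 = cnj (\<rho> $ 2 $ 1)"
    and re: "Re (\<rho> $ 1 $ 1) + Re (\<rho> $ 2 $ 2) = 1"
    using sa[of 1 1] sa[of 2 2] sa[of 1 2] tr by (simp_all add: complex_eq_iff)
  have \<rho>: "\<rho> = bloch r"
    using im off re by (simp add: bloch_def vec_eq_iff forall_2 pauli_nth mat_def r_def complex_eq_iff)
  \<comment> \<open>Measuring along the direction of \<open>r\<close> itself gives an outcome of
    probability \<open>(1 + norm r) / 2\<close>, which is at most 1.\<close>
  have "norm r \<le> 1"
  proof (cases "r = 0")
    case False
    define n where "n = (1 / norm r) *\<^sub>R r"
    have "norm n = 1" using False by (simp add: n_def)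
    from born_mem[OF assms bloch_projection[OF this]]
    have "(1 + r \<bullet> n) / 2 \<le> 1" by (simp add: \<rho> born_bloch)
    moreover have "r \<bullet> n = norm r" using False by (simp add: n_def dot_square_norm power2_eq_square)
    ultimately show ?thesis by simp
  qed simp
  with \<rho> show thesis by (rule that)
qed

lemma pvm_information_bloch:
  assumes "density_operator (bloch r)" "density_operator (bloch s)" "0 < a" "a < 1"
    and n: "norm n = 1" and k: "k \<noteq> 0"
  shows "pvm_information a (bloch r) (bloch s) (c *\<^sub>R mat 1 + k *\<^sub>R pauli n) =
    bloch_entropy (a * (r \<bullet> n) + (1 - a) * (s \<bullet> n))
    - a * bloch_entropy (r \<bullet> n) - (1 - a) * bloch_entropy (s \<bullet> n)"
proof -
  have conv: "a * ((1 + x) / 2) + (1 - a) * ((1 + y) / 2) = (1 + (a * x + (1 - a) * y)) / 2" for x y :: real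
    by (simp add: field_simps)
  show ?thesis
    unfolding pvm_information_eq[OF assms(1-4) self_adjoint_combination spectral_projection_bloch[OF n k]]
      born_bloch bloch_entropy_def conv by (rule refl)
qed

lemma scalar_operator_bloch: "scalar_operator (bloch r) \<longleftrightarrow> r = 0"
proof
  assume "scalar_operator (bloch r)"
  then obtain c where c: "bloch r = mat c" by (auto simp: scalar_operator_def)
  have "bloch r $ 1 $ 1 = bloch r $ 2 $ 2" "bloch r $ 2 $ 1 = 0" by (simp_all add: c mat_def)
  then show "r = 0"
    by (simp add: bloch_def pauli_nth mat_def complex_eq_iff vec_eq_iff forall_3)
next
  assume "r = 0"
  then have "bloch r = mat (1 / 2)"
    by (simp add: bloch_def vec_eq_iff forall_2 pauli_nth mat_def complex_eq_iff)
  then show "scalar_operator (bloch r)" by (auto simp: scalar_operator_def)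
qed

lemma bloch_diff: "bloch r - bloch s = (1 / 2) *\<^sub>R pauli (r - s)"
  by (simp add: bloch_def pauli_linear algebra_simps)

lemma bloch_parallel_commute: "bloch (p *\<^sub>R r) ** bloch (q *\<^sub>R r) = bloch (q *\<^sub>R r) ** bloch (p *\<^sub>R r)"
  by (simp add: bloch_def pauli_linear matrix_mult_scaleR matrix_add_ldistrib matrix_add_rdistrib algebra_simps)

lemma mu_bloch: "mu (bloch r) (bloch s) = (s \<bullet> (s - r)) / (norm (r - s))\<^sup>2"
  by (simp add: mu_def bloch_diff matrix_mult_scaleR trace_scaleR trace_bloch_pauli
      trace_pauli_pauli dot_square_norm)

lemma omega_mu_bloch: "omega_mu (bloch r) (bloch s) = bloch (s + mu (bloch r) (bloch s) *\<^sub>R (r - s))"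
  by (simp add: omega_mu_def bloch_def pauli_linear algebra_simps flip: scaleR_add_left)

section \<open>The information along the line\<close>

lemma quasi_concave_on_constant:
  assumes "\<And>x y. x \<in> S \<Longrightarrow> y \<in> S \<Longrightarrow> {x..y} \<subseteq> S" and "\<And>x. x \<in> S \<Longrightarrow> f x = k"
  shows "quasi_concave_on S f"
  unfolding quasi_concave_on_def order_interval_def
proof (intro allI ballI subsetI CollectI)
  fix c x y z assume xy: "x \<in> {x \<in> S. c \<le> f x}" "y \<in> {x \<in> S. c \<le> f x}" and "z \<in> {x..y}"
  then have "z \<in> S" using assms(1)[of x y] by blast
  with xy assms(2)[of x] assms(2)[of z] show "z \<in> S \<and> c \<le> f z" by simp
qed

lemma not_nondegenerate_scalar:
  assumes "scalar_operator A"
  shows "\<not> nondegenerate A"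
proof -
  obtain c where A: "A = mat c" using assms by (auto simp: scalar_operator_def)
  have "e = c" if e: "e \<in> eigenvalues A" for e
  proof -
    obtain v where v: "v \<noteq> 0" "A *v v = e *s v" using e by (auto simp: eigenvalues_def eigenspace_def)
    then obtain i where "v $ i \<noteq> 0" by (auto simp: vec_eq_iff)
    moreover have "(A *v v) $ i = c * v $ i"
      by (simp add: A matrix_vector_mult_def mat_def if_distrib[where f = "\<lambda>z. z * _"] cong: if_cong)
    ultimately show ?thesis using v(2) by simp
  qed
  then show ?thesis unfolding nondegenerate_def by blast
qed

lemma bloch_inj: "bloch r = bloch s \<Longrightarrow> r = s"
proof -
  assume "bloch r = bloch s"
  then have "r \<bullet> v = s \<bullet> v" for v by (simp flip: trace_bloch_pauli)
  then show "r = s" by (metis vector_eq_rdot)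
qed

lemma pseudo_concave_on_constant:
  assumes "\<And>x. f x = (k::real)"
  shows "pseudo_concave_on S f"
proof -
  have "f = (\<lambda>_. k)" using assms by auto
  then show ?thesis
    unfolding pseudo_concave_on_def by (intro exI[of _ "\<lambda>_. 0"]) auto
qed

section \<open>The two states and their line in the Bloch ball\<close>

locale two_qubit_states =
  fixes a :: real and r0 r1 :: "real^3"
  assumes a: "0 < a" "a < 1"
    and density: "density_operator (bloch r0)" "density_operator (bloch r1)"
    and norm_le: "norm r0 \<le> 1" "norm r1 \<le> 1"
    and ne: "r0 \<noteq> r1"
begin

abbreviation "t \<equiv> mu (bloch r0) (bloch r1)"
definition "d = r0 - r1"
text \<open>The Bloch vector of \<open>omega_mu\<close>. The value of \<open>mu\<close> makes it
  orthogonal to \<open>d\<close>, so it is the foot of the perpendicular from the origin to the line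
  of the states.\<close>

definition "w = r1 + t *\<^sub>R d"

lemma norm_d_pos: "norm d > 0"
  using ne by (simp add: d_def)

lemma omega: "omega_mu (bloch r0) (bloch r1) = bloch w"
  by (simp add: omega_mu_bloch w_def d_def)

lemma states: "r0 = w + (1 - t) *\<^sub>R d" "r1 = w + (- t) *\<^sub>R d"
  by (simp_all add: w_def d_def algebra_simps)

lemma w_orthogonal: "w \<bullet> d = 0" "d \<bullet> w = 0"
proof -
  have "t * (d \<bullet> d) = - (r1 \<bullet> d)"
    using norm_d_pos by (simp add: mu_bloch dot_square_norm flip: d_def) (simp add: d_def inner_diff_right)
  then show "w \<bullet> d = 0" by (simp add: w_def inner_add_left)
  then show "d \<bullet> w = 0" by (simp add: inner_commute)
qed

lemma H_eq: "H (bloch r0) (bloch r1) l = (l / 2) *\<^sub>R mat 1 + (1 / 2) *\<^sub>R pauli (l *\<^sub>R w - d)"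
  unfolding H_def omega bloch_diff by (simp add: bloch_def d_def pauli_linear algebra_simps)

text \<open>For \<open>w = 0\<close> the parameter enters \<open>H\<close> only through its identity
  part; the measurement axis is always that of \<open>d\<close>.\<close>

lemma I_TD_scalar:
  assumes "w = 0"
  shows "I_TD a (bloch r0) (bloch r1) l = I_TD a (bloch r0) (bloch r1) 0"
proof -
  define n where "n = (1 / norm d) *\<^sub>R d"
  have n: "norm n = 1" using norm_d_pos by (simp add: n_def)
  have "H (bloch r0) (bloch r1) l = (l / 2) *\<^sub>R mat 1 + (- norm d / 2) *\<^sub>R pauli n" for l
    using norm_d_pos by (simp add: H_eq assms n_def pauli_linear)
  then have "I_TD a (bloch r0) (bloch r1) l = bloch_entropy (a * (r0 \<bullet> n) + (1 - a) * (r1 \<bullet> n))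
    - a * bloch_entropy (r0 \<bullet> n) - (1 - a) * bloch_entropy (r1 \<bullet> n)" for l
    using norm_d_pos unfolding I_TD_def by (simp only:) (intro pvm_information_bloch density a n, simp)
  then show ?thesis by simp
qed

lemma commute_scalar:
  assumes "w = 0"
  shows "bloch r0 ** bloch r1 = bloch r1 ** bloch r0"
proof -
  obtain p q where "r0 = p *\<^sub>R d" "r1 = q *\<^sub>R d" using states assms by (metis add_0)
  then show ?thesis by (metis bloch_parallel_commute)
qed

text \<open>\<open>x0\<close> and \<open>x1\<close> are the coordinates of \<open>r0\<close> and
  \<open>r1\<close> along \<open>d\<close>, measured from the foot \<open>w\<close>.\<close>

definition "x0 = (1 - t) * norm d"
definition "x1 = - t * norm d"
text \<open>The axis of \<open>H\<close> at \<open>l\<close> is that of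
  \<open>d - l *\<^sub>R w\<close>, whose slope relative to \<open>d\<close> is the argument of
  \<open>arctan\<close>. The minus sign makes the angle decrease in \<open>l\<close> when
  \<open>w \<noteq> 0\<close>.\<close>

definition "angle l = arctan (- (norm w / norm d) * l)"

lemma pythagoras: "x0\<^sup>2 + (norm w)\<^sup>2 \<le> 1" "x1\<^sup>2 + (norm w)\<^sup>2 \<le> 1"
proof -
  have "(norm (w + c *\<^sub>R d))\<^sup>2 = (c * norm d)\<^sup>2 + (norm w)\<^sup>2" for c
    by (simp add: power2_norm_eq_inner inner_add_left inner_add_right w_orthogonal power_mult_distrib)
      (simp add: power2_eq_square)
  from this[of "1 - t"] this[of "- t"]
  have "x0\<^sup>2 + (norm w)\<^sup>2 = (norm r0)\<^sup>2" "x1\<^sup>2 + (norm w)\<^sup>2 = (norm r1)\<^sup>2"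
    unfolding x0_def x1_def states[symmetric] by simp_all
  then show "x0\<^sup>2 + (norm w)\<^sup>2 \<le> 1" "x1\<^sup>2 + (norm w)\<^sup>2 \<le> 1"
    using norm_le by (simp_all add: power_le_one)
qed

lemma x1_less_x0: "x1 < x0"
  using norm_d_pos by (simp add: x0_def x1_def algebra_simps)

lemma I_TD_angle: "I_TD a (bloch r0) (bloch r1) l = angle_information a x0 x1 (norm w) (angle l)"
proof -
  define s where "s = - (norm w / norm d) * l"
  \<comment> \<open>The length of \<open>d - l *\<^sub>R w\<close>, by orthogonality of
    \<open>d\<close> and \<open>w\<close>.\<close>
  define R where "R = norm d * sqrt (1 + s\<^sup>2)"
  have q: "sqrt (1 + s\<^sup>2) > 0" by (simp add: add_pos_nonneg)
  have R: "R > 0" using norm_d_pos q by (simp add: R_def)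
  have "(norm (d - l *\<^sub>R w))\<^sup>2 = (norm d)\<^sup>2 + l\<^sup>2 * (norm w)\<^sup>2"
    by (simp add: power2_norm_eq_inner inner_diff_left inner_diff_right w_orthogonal)
      (simp add: power2_eq_square)
  also have "\<dots> = R\<^sup>2"
    using norm_d_pos by (simp add: R_def s_def power_mult_distrib power_divide distrib_left add_nonneg_nonneg)
  finally have nR: "norm (d - l *\<^sub>R w) = R" using R by simp
  define n where "n = (1 / R) *\<^sub>R (d - l *\<^sub>R w)"
  have n: "norm n = 1" using nR R by (simp add: n_def)
  have "l *\<^sub>R w - d = (- R) *\<^sub>R n" using R by (simp add: n_def)
  then have "H (bloch r0) (bloch r1) l = (l / 2) *\<^sub>R mat 1 + (- R / 2) *\<^sub>R pauli n"
    by (simp add: H_eq pauli_linear)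
  then have I: "I_TD a (bloch r0) (bloch r1) l = bloch_entropy (a * (r0 \<bullet> n) + (1 - a) * (r1 \<bullet> n))
    - a * bloch_entropy (r0 \<bullet> n) - (1 - a) * bloch_entropy (r1 \<bullet> n)"
    using R unfolding I_TD_def by (simp only:) (intro pvm_information_bloch density a n, simp)
  have c: "cos (angle l) = norm d / R" "sin (angle l) = - l * norm w / R"
    using norm_d_pos unfolding angle_def s_def[symmetric] cos_arctan sin_arctan
    by (simp_all add: R_def) (simp add: s_def)
  have "(w + k *\<^sub>R d) \<bullet> n = k * norm d * cos (angle l) + norm w * sin (angle l)" for k
  proof -
    have "(w + k *\<^sub>R d) \<bullet> n = (k * (norm d)\<^sup>2 - l * (norm w)\<^sup>2) / R"
      by (simp add: n_def inner_add_left inner_diff_right w_orthogonal power2_norm_eq_inner)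
    then show ?thesis by (simp add: c power2_eq_square diff_divide_distrib mult_ac)
  qed
  from this[of "1 - t"] this[of "- t"]
  have rn: "r0 \<bullet> n = x0 * cos (angle l) + norm w * sin (angle l)"
    "r1 \<bullet> n = x1 * cos (angle l) + norm w * sin (angle l)"
    unfolding states[symmetric] x0_def x1_def by simp_all
  have "a * (r0 \<bullet> n) + (1 - a) * (r1 \<bullet> n) = (a * x0 + (1 - a) * x1) * cos (angle l) + norm w * sin (angle l)"
    unfolding rn by (simp add: algebra_simps)
  then show ?thesis unfolding I angle_information_def rn by simp
qed

lemma angle_information_right_angle:
  "angle_information a x y h (pi / 2) = 0" "angle_information a x y h (- (pi / 2)) = 0"
  by (simp_all add: angle_information_def bloch_entropy_minus algebra_simps)

text \<open>In the eigenbasis of \<open>omega_mu\<close> both states have the component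
  \<open>norm w\<close> along the axis, so the outcome carries no information about the
  letter.\<close>

lemma I_TD_ext_infinite:
  assumes "w \<noteq> 0" "\<bar>x\<bar> = \<infinity>"
  shows "I_TD_ext a (bloch r0) (bloch r1) x = 0"
proof -
  define n where "n = (1 / norm w) *\<^sub>R w"
  have n: "norm n = 1" using assms by (simp add: n_def)
  have "bloch w = (1 / 2) *\<^sub>R mat 1 + (norm w / 2) *\<^sub>R pauli n"
    using assms by (simp add: bloch_def n_def pauli_linear scaleR_right_distrib)
  moreover have "(w + k *\<^sub>R d) \<bullet> n = norm w" for k
    using assms by (simp add: n_def inner_add_left w_orthogonal dot_square_norm power2_eq_square)
  then have "r0 \<bullet> n = norm w" "r1 \<bullet> n = norm w" by (metis states)+
  moreover have "norm w / 2 \<noteq> 0" using assms by simp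
  ultimately show ?thesis
    using assms pvm_information_bloch[OF density a n, of "norm w / 2" "1 / 2"]
    by (simp add: I_TD_ext_def H_ext_def omega algebra_simps)
qed

text \<open>The endpoints are swapped because \<open>angle\<close> is decreasing. The angles
  \<open>pi / 2\<close> and \<open>- (pi / 2)\<close> describe the same unoriented axis.\<close>

definition ext_angle :: "ereal \<Rightarrow> real" where
  "ext_angle x = (if x = \<infinity> then - (pi / 2) else if x = - \<infinity> then pi / 2 else angle (real_of_ereal x))"

lemma ext_angle_simps: "ext_angle \<infinity> = - (pi / 2)" "ext_angle (- \<infinity>) = pi / 2" "ext_angle (ereal l) = angle l"
  by (simp_all add: ext_angle_def)

lemma I_TD_ext_angle:
  assumes "w \<noteq> 0"
  shows "I_TD_ext a (bloch r0) (bloch r1) x = angle_information a x0 x1 (norm w) (ext_angle x)"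
proof (cases x)
  case (real l)
  then have "I_TD_ext a (bloch r0) (bloch r1) x = I_TD a (bloch r0) (bloch r1) l"
    by (simp add: I_TD_ext_def I_TD_def H_ext_def)
  with real show ?thesis by (simp add: I_TD_angle ext_angle_simps)
qed (use assms in \<open>simp_all add: I_TD_ext_infinite ext_angle_simps angle_information_right_angle\<close>)

lemma angle_bounds: "- (pi / 2) < angle l" "angle l < pi / 2"
  by (simp_all only: angle_def arctan_lbound arctan_ubound)

lemma ext_angle_bounds: "- (pi / 2) \<le> ext_angle x" "ext_angle x \<le> pi / 2"
  using angle_bounds[of "real_of_ereal x"] by (simp_all add: ext_angle_def)

lemma angle_less_iff:
  assumes "w \<noteq> 0"
  shows "angle k < angle l \<longleftrightarrow> l < k"
proof -
  have "norm w / norm d > 0" using assms norm_d_pos by simp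
  then show ?thesis unfolding angle_def arctan_less_iff by (metis mult_less_cancel_left_pos mult_minus_left neg_less_iff_less)
qed

lemma ext_angle_antimono:
  assumes "w \<noteq> 0" "x \<le> y"
  shows "ext_angle y \<le> ext_angle x"
proof (cases x; cases y)
  fix k l assume "x = ereal k" "y = ereal l"
  with assms angle_less_iff[of k l] show ?thesis by (auto simp: ext_angle_simps not_less[symmetric])
qed (use assms angle_bounds in \<open>auto simp: ext_angle_simps intro: less_imp_le\<close>)

lemma angle_has_real_derivative:
  assumes "w \<noteq> 0"
  shows "\<exists>D<0. (angle has_real_derivative D) (at l)"
proof (intro exI conjI)
  show "(angle has_real_derivative - (norm w / norm d) / (1 + (- (norm w / norm d) * l)\<^sup>2)) (at l)"
    unfolding angle_def[abs_def]
    by (rule derivative_eq_intros refl | simp add: divide_inverse mult_ac)+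
  have "norm w / norm d > 0" using assms norm_d_pos by simp
  then show "- (norm w / norm d) / (1 + (- (norm w / norm d) * l)\<^sup>2) < 0"
    by (intro divide_neg_pos add_pos_nonneg) auto
qed

text \<open>Unimodality in the angle is carried over by the decreasing change of variable
  \<open>angle\<close>: the chain rule reverses the signs of the derivative, and order reversal
  swaps the two sides of the maximum.\<close>

lemma nonscalar:
  assumes w: "w \<noteq> 0"
  defines "I \<equiv> I_TD a (bloch r0) (bloch r1)" and "J \<equiv> I_TD_ext a (bloch r0) (bloch r1)"
  obtains m where "{x. \<forall>y. J y \<le> J x} = {ereal m}"
    "\<And>l. l < m \<Longrightarrow> \<exists>D>0. (I has_real_derivative D) (at l)"
    "\<And>l. m < l \<Longrightarrow> \<exists>D<0. (I has_real_derivative D) (at l)"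
    "quasi_concave_on UNIV J"
    "pseudo_concave_on S I"
proof -
  define F where "F = angle_information a x0 x1 (norm w)"
  define G where "G = angle_information_deriv a x0 x1 (norm w)"
  have IF: "I l = F (angle l)" for l by (simp add: I_def F_def I_TD_angle)
  have JF: "J x = F (ext_angle x)" for x by (simp add: J_def F_def I_TD_ext_angle[OF w])
  have dF: "(F has_real_derivative G \<theta>) (at \<theta>)" for \<theta>
    unfolding F_def G_def using pythagoras a by (intro angle_information_has_real_derivative) auto
  have cont: "continuous_on A F" for A
    using dF by (meson DERIV_isCont continuous_at_imp_continuous_on)
  obtain \<mu> where \<mu>: "- (pi / 2) < \<mu>" "\<mu> < pi / 2" "G \<mu> = 0"
    and up: "\<And>\<theta>. - (pi / 2) < \<theta> \<Longrightarrow> \<theta> < \<mu> \<Longrightarrow> 0 < G \<theta>"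
    and down: "\<And>\<theta>. \<mu> < \<theta> \<Longrightarrow> \<theta> < pi / 2 \<Longrightarrow> G \<theta> < 0"
    using angle_information_unimodal[OF pythagoras x1_less_x0 _ a] w unfolding G_def
    by (metis minus_divide_left zero_less_norm_iff)
  have incr: "F p < F q" if "- (pi / 2) \<le> p" "p < q" "q \<le> \<mu>" for p q
    using that dF up by (intro DERIV_pos_imp_increasing_open[OF that(2) _ cont]) (meson le_less_trans less_le_trans)
  have decr: "F q < F p" if "\<mu> \<le> p" "p < q" "q \<le> pi / 2" for p q
    using that dF down by (intro DERIV_neg_imp_decreasing_open[OF that(2) _ cont]) (meson le_less_trans less_le_trans)
  have max: "F \<theta> < F \<mu>" if "- (pi / 2) \<le> \<theta>" "\<theta> \<le> pi / 2" "\<theta> \<noteq> \<mu>" for \<theta>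
    using that incr[of \<theta> \<mu>] decr[of \<mu> \<theta>] by (cases \<theta> \<mu> rule: linorder_cases) auto
  \<comment> \<open>The parameter whose axis has the maximizing angle; it is finite because \<mu>
    lies strictly between the right angles.\<close>
  define m where "m = - (norm d / norm w) * tan \<mu>"
  have am: "angle m = \<mu>"
    using w norm_d_pos \<mu> by (simp add: angle_def m_def arctan_tan)
  have ext: "ext_angle x = \<mu> \<longleftrightarrow> x = ereal m" for x
  proof (cases x)
    case (real l)
    then show ?thesis using am angle_less_iff[OF w] by (simp add: ext_angle_simps) (metis less_irrefl linorder_neqE)
  qed (use \<mu> in \<open>simp_all add: ext_angle_simps\<close>)
  have less: "J x < J (ereal m)" if "x \<noteq> ereal m" for x
    using max[OF ext_angle_bounds, of x] ext that by (simp add: JF ext_angle_simps am)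
  have 1: "{x. \<forall>y. J y \<le> J x} = {ereal m}"
  proof (intro equalityI subsetI)
    show "x \<in> {ereal m}" if "x \<in> {x. \<forall>y. J y \<le> J x}" for x
      using that less[of x] by (metis (mono_tags) insertI1 mem_Collect_eq not_le)
    have "J y \<le> J (ereal m)" for y using less[of y] by (cases "y = ereal m") auto
    then show "x \<in> {x. \<forall>y. J y \<le> J x}" if "x \<in> {ereal m}" for x using that by simp
  qed
  obtain g where g: "\<And>l. g l < 0" "\<And>l. (angle has_real_derivative g l) (at l)"
    using angle_has_real_derivative[OF w] by metis
  have dI: "(I has_real_derivative G (angle l) * g l) (at l)" for l
    using DERIV_chain2[OF dF g(2)] by (simp add: IF[abs_def])
  have posd: "G (angle l) * g l > 0" if "l < m" for l
    using down[of "angle l"] angle_bounds g(1) angle_less_iff[OF w, of m l] that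
    by (simp add: am mult_neg_neg)
  have negd: "G (angle l) * g l < 0" if "m < l" for l
    using up[of "angle l"] angle_bounds g(1) angle_less_iff[OF w, of l m] that
    by (simp add: am mult_pos_neg)
  have "quasi_concave_on UNIV J"
    unfolding quasi_concave_on_def order_interval_def
  proof (intro allI ballI subsetI CollectI conjI UNIV_I)
    fix c x y z assume xy: "x \<in> {x \<in> UNIV. c \<le> J x}" "y \<in> {x \<in> UNIV. c \<le> J x}" and z: "z \<in> {x..y}"
    have o: "ext_angle y \<le> ext_angle z" "ext_angle z \<le> ext_angle x"
      using z ext_angle_antimono[OF w] by auto
    \<comment> \<open>The angle of \<open>z\<close> lies between those of \<open>x\<close> and
      \<open>y\<close>. Left of \<mu> the function \<open>F\<close> increases from the angle of
      \<open>y\<close> to that of \<open>z\<close>; right of \<mu> it decreases from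
      \<open>z\<close> to \<open>x\<close>.\<close>
    have "F (ext_angle y) \<le> F (ext_angle z) \<or> F (ext_angle x) \<le> F (ext_angle z)"
    proof (cases "ext_angle z \<le> \<mu>")
      case True
      then show ?thesis using o incr[of "ext_angle y" "ext_angle z"] ext_angle_bounds
        by (cases "ext_angle y = ext_angle z") auto
    next
      case False
      then show ?thesis using o decr[of "ext_angle z" "ext_angle x"] ext_angle_bounds
        by (cases "ext_angle z = ext_angle x") auto
    qed
    then show "c \<le> J z" using xy by (auto simp: JF)
  qed
  moreover have "pseudo_concave_on S I"
    unfolding pseudo_concave_on_def
  proof (intro exI conjI ballI impI)
    show "(I has_real_derivative G (angle x) * g x) (at x within S)" for x
      using dI by (rule has_field_derivative_at_within)
    fix x y assume less: "I x < I y"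
    consider "x < m" | "x = m" | "m < x" by linarith
    then show "0 < G (angle x) * g x * (y - x)"
    proof cases
      case 1
      have "x < y"
      proof (rule ccontr)
        assume "\<not> x < y"
        then have "angle x \<le> angle y" using angle_less_iff[OF w, of y x] by linarith
        moreover have "\<mu> < angle x" using 1 angle_less_iff[OF w, of m x] am by simp
        ultimately show False
          using less decr[of "angle x" "angle y"] angle_bounds[of y] by (cases "angle x = angle y") (auto simp: IF)
      qed
      with posd[OF 1] show ?thesis by simp
    next
      case 2
      with less max[of "angle y"] angle_bounds[of y] am show ?thesis by (cases "angle y = \<mu>") (auto simp: IF)
    next
      case 3
      have "y < x"
      proof (rule ccontr)
        assume "\<not> y < x"
        then have "angle y \<le> angle x" using angle_less_iff[OF w, of x y] by linarith
        moreover have "angle x < \<mu>" using 3 angle_less_iff[OF w, of x m] am by simp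
        ultimately show False
          using less incr[of "angle y" "angle x"] angle_bounds[of y] by (cases "angle x = angle y") (auto simp: IF)
      qed
      with negd[OF 3] show ?thesis by (simp add: mult_neg_neg)
    qed
  qed
  ultimately show thesis using that[OF 1] dI posd negd by blast
qed

section \<open>The nondegenerate branch for scalar \<open>omega_mu\<close>\<close>

lemma finite_iff_nondegenerate:
  assumes "w = 0"
  shows "nondegenerate (H_ext (bloch r0) (bloch r1) x) \<longleftrightarrow> \<bar>x\<bar> \<noteq> \<infinity>"
proof (cases "\<bar>x\<bar> = \<infinity>")
  case True
  have "scalar_operator (bloch w)" using assms scalar_operator_bloch by blast
  with True show ?thesis by (simp add: H_ext_def omega not_nondegenerate_scalar)
next
  case False
  have "bloch r0 \<noteq> bloch r1" using bloch_inj ne by blast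
  with False H_nondegenerate(2)[OF density] show ?thesis by (simp add: H_ext_def)
qed

lemma quasi_concave_scalar:
  assumes "w = 0"
  shows "quasi_concave_on {x. nondegenerate (H_ext (bloch r0) (bloch r1) x)} (I_TD_ext a (bloch r0) (bloch r1))"
proof (rule quasi_concave_on_constant)
  show "{x..y} \<subseteq> {x. nondegenerate (H_ext (bloch r0) (bloch r1) x)}"
    if "x \<in> {x. nondegenerate (H_ext (bloch r0) (bloch r1) x)}"
      "y \<in> {x. nondegenerate (H_ext (bloch r0) (bloch r1) x)}" for x y
    using that by (cases x; cases y) (auto simp: finite_iff_nondegenerate[OF assms])
  show "I_TD_ext a (bloch r0) (bloch r1) x = I_TD a (bloch r0) (bloch r1) 0"
    if "x \<in> {x. nondegenerate (H_ext (bloch r0) (bloch r1) x)}" for x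
  proof -
    have "\<bar>x\<bar> \<noteq> \<infinity>" using that by (simp only: finite_iff_nondegenerate[OF assms] mem_Collect_eq not_False_eq_True)
    then have "I_TD_ext a (bloch r0) (bloch r1) x = I_TD a (bloch r0) (bloch r1) (real_of_ereal x)"
      by (simp add: I_TD_ext_def I_TD_def H_ext_def)
    then show ?thesis by (rule trans) (rule I_TD_scalar[OF assms])
  qed
qed

end

theorem theorem10p3:
  fixes \<rho>0 \<rho>1 :: "complex^2^2" and a b :: real
  assumes "density_operator \<rho>0" and "density_operator \<rho>1" and "\<rho>0 \<noteq> \<rho>1"
    and "a > 0" and "b > 0" and "a + b = 1"
  shows
    "(\<not> scalar_operator (omega_mu \<rho>0 \<rho>1) \<longrightarrow>
        (\<exists>l_max::real.
           {x. \<forall>y. I_TD_ext a \<rho>0 \<rho>1 y \<le> I_TD_ext a \<rho>0 \<rho>1 x} = {ereal l_max} \<and>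
           (\<forall>l<l_max. \<exists>D>0. (I_TD a \<rho>0 \<rho>1 has_real_derivative D) (at l)) \<and>
           (\<forall>l>l_max. \<exists>D<0. (I_TD a \<rho>0 \<rho>1 has_real_derivative D) (at l))) \<and>
        (I_TD_ext a \<rho>0 \<rho>1 (-\<infinity>) = I_TD_ext a \<rho>0 \<rho>1 \<infinity> \<and>
         quasi_concave_on UNIV (I_TD_ext a \<rho>0 \<rho>1)) \<and>
        pseudo_concave_on {- lambda_star \<rho>0 \<rho>1 .. lambda_star \<rho>0 \<rho>1} (I_TD a \<rho>0 \<rho>1) \<and>
        (\<forall>x\<in>{- lambda_star \<rho>0 \<rho>1 .. lambda_star \<rho>0 \<rho>1}.
           (I_TD a \<rho>0 \<rho>1 has_real_derivative 0) (at x) \<longrightarrow>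
           (\<forall>y. I_TD_ext a \<rho>0 \<rho>1 y \<le> I_TD_ext a \<rho>0 \<rho>1 (ereal x)))) \<and>
     (scalar_operator (omega_mu \<rho>0 \<rho>1) \<longrightarrow>
        \<rho>0 ** \<rho>1 = \<rho>1 ** \<rho>0 \<and>
        I_TD a \<rho>0 \<rho>1 constant_on {l. nondegenerate (H \<rho>0 \<rho>1 l)} \<and>
        quasi_concave_on {x. nondegenerate (H_ext \<rho>0 \<rho>1 x)} (I_TD_ext a \<rho>0 \<rho>1) \<and>
        pseudo_concave_on {l. nondegenerate (H \<rho>0 \<rho>1 l)} (I_TD a \<rho>0 \<rho>1) \<and>
        pseudo_concave_on {- lambda_star \<rho>0 \<rho>1 .. lambda_star \<rho>0 \<rho>1} (I_TD a \<rho>0 \<rho>1))"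
proof -
  obtain r0 r1 where r: "\<rho>0 = bloch r0" "norm r0 \<le> 1" "\<rho>1 = bloch r1" "norm r1 \<le> 1"
    using density_operator_bloch assms(1,2) by metis
  interpret two_qubit_states a r0 r1
    using assms r by unfold_locales auto
  have scalar: "scalar_operator (omega_mu \<rho>0 \<rho>1) \<longleftrightarrow> w = 0"
    unfolding r omega scalar_operator_bloch by (rule refl)
  define S where "S = {- lambda_star \<rho>0 \<rho>1 .. lambda_star \<rho>0 \<rho>1}"
  show ?thesis
    unfolding scalar S_def[symmetric]
  proof (intro conjI impI)
    assume w: "w \<noteq> 0"
    obtain m where m: "{x. \<forall>y. I_TD_ext a \<rho>0 \<rho>1 y \<le> I_TD_ext a \<rho>0 \<rho>1 x} = {ereal m}"
      "\<And>l. l < m \<Longrightarrow> \<exists>D>0. (I_TD a \<rho>0 \<rho>1 has_real_derivative D) (at l)"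
      "\<And>l. m < l \<Longrightarrow> \<exists>D<0. (I_TD a \<rho>0 \<rho>1 has_real_derivative D) (at l)"
      "quasi_concave_on UNIV (I_TD_ext a \<rho>0 \<rho>1)" "pseudo_concave_on S (I_TD a \<rho>0 \<rho>1)"
      using nonscalar[OF w] unfolding r by metis
    show "\<exists>l_max. {x. \<forall>y. I_TD_ext a \<rho>0 \<rho>1 y \<le> I_TD_ext a \<rho>0 \<rho>1 x} = {ereal l_max} \<and>
        (\<forall>l<l_max. \<exists>D>0. (I_TD a \<rho>0 \<rho>1 has_real_derivative D) (at l)) \<and>
        (\<forall>l>l_max. \<exists>D<0. (I_TD a \<rho>0 \<rho>1 has_real_derivative D) (at l))"
      using m(1-3) by blast
    show "I_TD_ext a \<rho>0 \<rho>1 (- \<infinity>) = I_TD_ext a \<rho>0 \<rho>1 \<infinity>"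
      unfolding r by (simp add: I_TD_ext_infinite[OF w])
    show "quasi_concave_on UNIV (I_TD_ext a \<rho>0 \<rho>1)" "pseudo_concave_on S (I_TD a \<rho>0 \<rho>1)"
      by (rule m)+
    show "\<forall>x\<in>S. (I_TD a \<rho>0 \<rho>1 has_real_derivative 0) (at x) \<longrightarrow>
        (\<forall>y. I_TD_ext a \<rho>0 \<rho>1 y \<le> I_TD_ext a \<rho>0 \<rho>1 (ereal x))"
    proof (intro ballI impI)
      fix x assume "(I_TD a \<rho>0 \<rho>1 has_real_derivative 0) (at x)"
      \<comment> \<open>Away from \<open>m\<close> the derivative exists and is nonzero, so by
        uniqueness of derivatives a stationary point can only be \<open>m\<close>.\<close>
      then have "x = m" using m(2,3) DERIV_unique by (metis less_irrefl linorder_neqE)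
      then show "\<forall>y. I_TD_ext a \<rho>0 \<rho>1 y \<le> I_TD_ext a \<rho>0 \<rho>1 (ereal x)" using m(1) by blast
    qed
  next
    assume w: "w = 0"
    have const: "I_TD a \<rho>0 \<rho>1 l = I_TD a \<rho>0 \<rho>1 0" for l
      unfolding r by (rule I_TD_scalar[OF w])
    show "\<rho>0 ** \<rho>1 = \<rho>1 ** \<rho>0" unfolding r by (rule commute_scalar[OF w])
    show "I_TD a \<rho>0 \<rho>1 constant_on {l. nondegenerate (H \<rho>0 \<rho>1 l)}"
      unfolding constant_on_def using const by blast
    show "quasi_concave_on {x. nondegenerate (H_ext \<rho>0 \<rho>1 x)} (I_TD_ext a \<rho>0 \<rho>1)"
      unfolding r by (rule quasi_concave_scalar[OF w])
    show "pseudo_concave_on {l. nondegenerate (H \<rho>0 \<rho>1 l)} (I_TD a \<rho>0 \<rho>1)"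
      "pseudo_concave_on S (I_TD a \<rho>0 \<rho>1)"
      using const by (rule pseudo_concave_on_constant)+
  qed
qed

end
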